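(* Let $R$ be a commutative unital ring. Let $C$ be a pathlike $R$-coalgebra and $A$ an $R$-algebra with $\mathrm{Ext}^1_R(C/F^{Q_{\bullet\bullet}}_0C,A)=0$. An element $f\in\mathrm{Hom}(C,A)$ has a $\star$-inverse in the convolution algebra $\mathrm{Hom}(C,A)$ if and only if for every grouplike element $g$ of $C$, $f(g)$ has an inverse as a ring element in $A$. In particular, in this situation (when $C$ is the underlying coalgebra of a bialgebra), a character, i.e. an algebra homomorphism to $A$, is $\star$-invertible if and only if it is grouplike invertible. Furthermore, a pathlike bialgebra $B$ is a Hopf algebra if and only if the set of grouplike elements of $B$ forms a group (under multiplication).
   Context: All tensor products and $\mathrm{Hom}$'s are over $R$; algebras are unital, coalgebras counital with counit $\epsilon$. For submodules $M,N\subset C$, $M\boxtimes N\subset C\otimes C$ is the submodule of finite sums of $x\otimes y$, $x\in M,y\in N$. The convolution algebra $\mathrm{Hom}(C,A)$ has product $(f\star g)(x)=\sum f(x_{(1)})g(x_{(2)})$ and unit $\eta_A\circ\epsilon$. $\mathrm{sgpl}(C)$ is the set of nonzero semigrouplike elements ($\Delta(g)=g\otimes g$, $g\ne0$); $\mathrm{gpl}(C)$ is the set of grouplike elements ($\Delta(g)=g\otimes g$ and $\epsilon(g)=1$). A character $\phi$ is grouplike invertible if $\phi(g)\in A^\times$ for every grouplike $g$. Bivariate Quillen filtration: for $g,h\in\mathrm{sgpl}(C)$ put $\overline\Delta_{g,h}(x)=\Delta(x)-g\otimes x-x\otimes h$. Define simultaneously for all pairs $F^Q_0C_{g,h}=Rg\cap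 Rh$ and, for $n\ge1$, $F^Q_nC_{g,h}=\{x\in C\mid \overline\Delta_{g,h}(x)\in\sum_{t\in\mathrm{sgpl}(C)}F^Q_{n-1}C_{g,t}\boxtimes F^Q_{n-1}C_{t,h}\}$. Then $F^{Q_{\bullet\bullet}}_nC=\sum_{g,h\in\mathrm{sgpl}(C)}F^Q_nC_{g,h}$. $C$ is sg-flavored if $C=\bigcup_nF^{Q_{\bullet\bullet}}_nC$. An sg-flavored coalgebra is pathlike if (1) $\mathrm{sgpl}(C)=\mathrm{gpl}(C)$ and (2) $F^{Q_{\bullet\bullet}}_0C$ is the free $R$-module on $\mathrm{gpl}(C)$, i.e. $F^{Q_{\bullet\bullet}}_0C=\bigoplus_{g\in\mathrm{gpl}(C)}Rg$. A bialgebra is pathlike if its underlying coalgebra is. *)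

theory Defs
  imports "HOL-Algebra.Module" "HOL-Algebra.QuotRing"
begin

text \<open>
  Modules are the records of \<^theory>\<open>HOL-Algebra.Module\<close>. These records extend rings; for a
  plain module the fields \<^const>\<open>mult\<close> and \<^const>\<open>one\<close> carry no meaning and are left
  \<^const>\<open>undefined\<close>.
\<close>

section \<open>Linear maps, free modules, quotients\<close>

definition finite_sums :: "('a, 'm) ring_scheme \<Rightarrow> 'a set \<Rightarrow> 'a set" where
  "finite_sums M S = {finsum M s {..<n} | (n::nat) s. s \<in> {..<n} \<rightarrow> S}"

definition linear_maps ::
  "('r, 'x) ring_scheme \<Rightarrow> ('r, 'm, 'y) module_scheme \<Rightarrow> ('r, 'n, 'z) module_scheme \<Rightarrow> ('m \<Rightarrow> 'n) set"
  where
  "linear_maps R M N = {f \<in> carrier M \<rightarrow> carrier N.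
     (\<forall>x\<in>carrier M. \<forall>y\<in>carrier M. f (x \<oplus>\<^bsub>M\<^esub> y) = f x \<oplus>\<^bsub>N\<^esub> f y) \<and>
     (\<forall>a\<in>carrier R. \<forall>x\<in>carrier M. f (a \<odot>\<^bsub>M\<^esub> x) = a \<odot>\<^bsub>N\<^esub> f x)}"

text \<open>The elements of the Hom module are extensional, so that each linear map occurs once.\<close>

definition hom_module ::
  "('r, 'x) ring_scheme \<Rightarrow> ('r, 'm, 'y) module_scheme \<Rightarrow> ('r, 'n, 'z) module_scheme \<Rightarrow>
   ('r, 'm \<Rightarrow> 'n) module"
  where
  "hom_module R M N =
     \<lparr>carrier = linear_maps R M N \<inter> extensional (carrier M),
      mult = undefined, one = undefined,
      zero = (\<lambda>x\<in>carrier M. \<zero>\<^bsub>N\<^esub>),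
      add = (\<lambda>f g. \<lambda>x\<in>carrier M. f x \<oplus>\<^bsub>N\<^esub> g x),
      smult = (\<lambda>a f. \<lambda>x\<in>carrier M. a \<odot>\<^bsub>N\<^esub> f x)\<rparr>"

definition regular_module :: "('r, 'x) ring_scheme \<Rightarrow> ('r, 'r) module" where
  "regular_module R =
     \<lparr>carrier = carrier R, mult = mult R, one = one R, zero = zero R, add = add R, smult = mult R\<rparr>"

definition free_module :: "('r, 'x) ring_scheme \<Rightarrow> 'i set \<Rightarrow> ('r, 'i \<Rightarrow> 'r) module" where
  "free_module R I =
     \<lparr>carrier = {c. range c \<subseteq> carrier R \<and> {i. c i \<noteq> \<zero>\<^bsub>R\<^esub>} \<subseteq> I \<and> finite {i. c i \<noteq> \<zero>\<^bsub>R\<^esub>}},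
      mult = undefined, one = undefined,
      zero = (\<lambda>i. \<zero>\<^bsub>R\<^esub>),
      add = (\<lambda>c d i. c i \<oplus>\<^bsub>R\<^esub> d i),
      smult = (\<lambda>a c i. a \<otimes>\<^bsub>R\<^esub> c i)\<rparr>"

definition basis_vector :: "('r, 'x) ring_scheme \<Rightarrow> 'i \<Rightarrow> 'i \<Rightarrow> 'r" where
  "basis_vector R i = (\<lambda>j. if j = i then \<one>\<^bsub>R\<^esub> else \<zero>\<^bsub>R\<^esub>)"

text \<open>The linear extension to the free module of a family \<open>v\<close> of elements of \<open>M\<close>.\<close>

definition free_lift ::
  "('r, 'x) ring_scheme \<Rightarrow> ('r, 'm, 'y) module_scheme \<Rightarrow> ('i \<Rightarrow> 'm) \<Rightarrow> ('i \<Rightarrow> 'r) \<Rightarrow> 'm" where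
  "free_lift R M v c = finsum M (\<lambda>i. c i \<odot>\<^bsub>M\<^esub> v i) {i. c i \<noteq> \<zero>\<^bsub>R\<^esub>}"

definition quotient_module :: "('r, 'm, 'y) module_scheme \<Rightarrow> 'm set \<Rightarrow> ('r, 'm set) module" where
  "quotient_module M N =
     \<lparr>carrier = a_rcosets\<^bsub>M\<^esub> N,
      mult = undefined, one = undefined,
      zero = N,
      add = (\<lambda>X Y. X <+>\<^bsub>M\<^esub> Y),
      smult = (\<lambda>a X. N <+>\<^bsub>M\<^esub> ((\<lambda>x. a \<odot>\<^bsub>M\<^esub> x) ` X))\<rparr>"


section \<open>The first Ext module\<close>

text \<open>
  \<open>Ext1 R M N\<close> is the first cohomology of \<open>Hom(P\<^sub>\<bullet>, N)\<close> for the canonical free resolution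
  \<open>P\<^sub>2 \<rightarrow> P\<^sub>1 \<rightarrow> P\<^sub>0 \<rightarrow> M\<close>, in which each term is free on the set of all elements of the
  kernel of the preceding map.
\<close>

definition syzygies ::
  "('r, 'x) ring_scheme \<Rightarrow> ('r, 'm, 'y) module_scheme \<Rightarrow> 'm set \<Rightarrow> ('m \<Rightarrow> 'r) set" where
  "syzygies R M S = {c \<in> carrier (free_module R S). free_lift R M (\<lambda>x. x) c = \<zero>\<^bsub>M\<^esub>}"

definition Ext1 ::
  "('r, 'x) ring_scheme \<Rightarrow> ('r, 'm, 'y) module_scheme \<Rightarrow> ('r, 'n, 'z) module_scheme \<Rightarrow>
   ('r, ((('m \<Rightarrow> 'r) \<Rightarrow> 'r) \<Rightarrow> 'n) set) module"
  where
  "Ext1 R M N =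
    (let P0 = free_module R (carrier M);
         K0 = syzygies R M (carrier M);
         P1 = free_module R K0;
         d1 = free_lift R P0 (\<lambda>x. x);
         K1 = syzygies R P0 K0;
         P2 = free_module R K1;
         d2 = free_lift R P1 (\<lambda>x. x);
         cocycles = {\<phi> \<in> carrier (hom_module R P1 N). \<forall>c\<in>carrier P2. \<phi> (d2 c) = \<zero>\<^bsub>N\<^esub>};
         coboundaries = {\<lambda>c\<in>carrier P1. \<psi> (d1 c) | \<psi>. \<psi> \<in> carrier (hom_module R P0 N)}
     in quotient_module ((hom_module R P1 N)\<lparr>carrier := cocycles\<rparr>) coboundaries)"


section \<open>Tensor products\<close>

definition bilinear_relations ::
  "('r, 'x) ring_scheme \<Rightarrow> ('r, 'm, 'y) module_scheme \<Rightarrow> ('r, 'n, 'z) module_scheme \<Rightarrow>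
   ('m \<times> 'n \<Rightarrow> 'r) set"
  where
  "bilinear_relations R M N =
    (let F = free_module R (carrier M \<times> carrier N); e = (\<lambda>x y. basis_vector R (x, y)) in
       {e (x \<oplus>\<^bsub>M\<^esub> x') y \<ominus>\<^bsub>F\<^esub> (e x y \<oplus>\<^bsub>F\<^esub> e x' y) | x x' y.
          x \<in> carrier M \<and> x' \<in> carrier M \<and> y \<in> carrier N}
     \<union> {e x (y \<oplus>\<^bsub>N\<^esub> y') \<ominus>\<^bsub>F\<^esub> (e x y \<oplus>\<^bsub>F\<^esub> e x y') | x y y'.
          x \<in> carrier M \<and> y \<in> carrier N \<and> y' \<in> carrier N}
     \<union> {e (a \<odot>\<^bsub>M\<^esub> x) y \<ominus>\<^bsub>F\<^esub> a \<odot>\<^bsub>F\<^esub> e x y | a x y.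
          a \<in> carrier R \<and> x \<in> carrier M \<and> y \<in> carrier N}
     \<union> {e x (a \<odot>\<^bsub>N\<^esub> y) \<ominus>\<^bsub>F\<^esub> a \<odot>\<^bsub>F\<^esub> e x y | a x y.
          a \<in> carrier R \<and> x \<in> carrier M \<and> y \<in> carrier N})"

definition tensor_kernel ::
  "('r, 'x) ring_scheme \<Rightarrow> ('r, 'm, 'y) module_scheme \<Rightarrow> ('r, 'n, 'z) module_scheme \<Rightarrow>
   ('m \<times> 'n \<Rightarrow> 'r) set"
  where
  "tensor_kernel R M N =
    (let F = free_module R (carrier M \<times> carrier N) in
       finite_sums F {a \<odot>\<^bsub>F\<^esub> r | a r. a \<in> carrier R \<and> r \<in> bilinear_relations R M N})"

definition tensor_product ::
  "('r, 'x) ring_scheme \<Rightarrow> ('r, 'm, 'y) module_scheme \<Rightarrow> ('r, 'n, 'z) module_scheme \<Rightarrow>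
   ('r, ('m \<times> 'n \<Rightarrow> 'r) set) module"
  where
  "tensor_product R M N =
     quotient_module (free_module R (carrier M \<times> carrier N)) (tensor_kernel R M N)"

definition pure_tensor ::
  "('r, 'x) ring_scheme \<Rightarrow> ('r, 'm, 'y) module_scheme \<Rightarrow> ('r, 'n, 'z) module_scheme \<Rightarrow>
   'm \<Rightarrow> 'n \<Rightarrow> ('m \<times> 'n \<Rightarrow> 'r) set"
  where
  "pure_tensor R M N x y =
     tensor_kernel R M N +>\<^bsub>free_module R (carrier M \<times> carrier N)\<^esub> basis_vector R (x, y)"

text \<open>
  The linear map out of the tensor product induced by a bilinear map \<open>\<beta>\<close> to \<open>P\<close>. An element of the
  tensor product is a coset of formal sums; for bilinear \<open>\<beta>\<close> all of them have the same image.
\<close>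

definition tensor_lift ::
  "('r, 'x) ring_scheme \<Rightarrow> ('r, 'p, 'y) module_scheme \<Rightarrow> ('m \<Rightarrow> 'n \<Rightarrow> 'p) \<Rightarrow>
   ('m \<times> 'n \<Rightarrow> 'r) set \<Rightarrow> 'p"
  where
  "tensor_lift R P \<beta> t = the_elem (free_lift R P (\<lambda>(x, y). \<beta> x y) ` t)"

definition tensor_map ::
  "('r, 'x) ring_scheme \<Rightarrow> ('r, 'p, 'y) module_scheme \<Rightarrow> ('r, 'q, 'z) module_scheme \<Rightarrow>
   ('m \<Rightarrow> 'p) \<Rightarrow> ('n \<Rightarrow> 'q) \<Rightarrow> ('m \<times> 'n \<Rightarrow> 'r) set \<Rightarrow> ('p \<times> 'q \<Rightarrow> 'r) set"
  where
  "tensor_map R P Q f g =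
     tensor_lift R (tensor_product R P Q) (\<lambda>x y. pure_tensor R P Q (f x) (g y))"

definition tensor_assoc ::
  "('r, 'x) ring_scheme \<Rightarrow> ('r, 'm, 'u) module_scheme \<Rightarrow> ('r, 'n, 'v) module_scheme \<Rightarrow>
   ('r, 'p, 'w) module_scheme \<Rightarrow>
   (('m \<times> 'n \<Rightarrow> 'r) set \<times> 'p \<Rightarrow> 'r) set \<Rightarrow> ('m \<times> ('n \<times> 'p \<Rightarrow> 'r) set \<Rightarrow> 'r) set"
  where
  "tensor_assoc R M N P =
    (let T = tensor_product R M (tensor_product R N P) in
       tensor_lift R T (\<lambda>t z. tensor_lift R T
         (\<lambda>x y. pure_tensor R M (tensor_product R N P) x (pure_tensor R N P y z)) t))"


section \<open>Algebras, coalgebras, bialgebras, Hopf algebras\<close>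

text \<open>
  The locale \<^locale>\<open>algebra\<close> of the library requires commutative multiplication.
\<close>

locale unital_algebra = module R A + A: ring A for R (structure) and A (structure) +
  assumes smult_mult_left: "\<lbrakk>a \<in> carrier R; x \<in> carrier A; y \<in> carrier A\<rbrakk> \<Longrightarrow>
      (a \<odot>\<^bsub>A\<^esub> x) \<otimes>\<^bsub>A\<^esub> y = a \<odot>\<^bsub>A\<^esub> (x \<otimes>\<^bsub>A\<^esub> y)"
    and smult_mult_right: "\<lbrakk>a \<in> carrier R; x \<in> carrier A; y \<in> carrier A\<rbrakk> \<Longrightarrow>
      x \<otimes>\<^bsub>A\<^esub> (a \<odot>\<^bsub>A\<^esub> y) = a \<odot>\<^bsub>A\<^esub> (x \<otimes>\<^bsub>A\<^esub> y)"

definition tensor_algebra ::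
  "('r, 'x) ring_scheme \<Rightarrow> ('r, 'a, 'y) module_scheme \<Rightarrow> ('r, 'b, 'z) module_scheme \<Rightarrow>
   ('r, ('a \<times> 'b \<Rightarrow> 'r) set) module"
  where
  "tensor_algebra R A B = (let T = tensor_product R A B in T
     \<lparr>mult := (\<lambda>s t. tensor_lift R T (\<lambda>x y. tensor_lift R T
                 (\<lambda>x' y'. pure_tensor R A B (x \<otimes>\<^bsub>A\<^esub> x') (y \<otimes>\<^bsub>B\<^esub> y')) t) s),
      one := pure_tensor R A B \<one>\<^bsub>A\<^esub> \<one>\<^bsub>B\<^esub>\<rparr>)"

text \<open>
  For a coalgebra the ring fields \<^const>\<open>mult\<close> and \<^const>\<open>one\<close> inherited from the module
  record carry no meaning; a bialgebra is a record of the same type in which they do.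
\<close>

record ('r, 'c) coalgebra = "('r, 'c) module" +
  comult :: "'c \<Rightarrow> ('c \<times> 'c \<Rightarrow> 'r) set"
  counit :: "'c \<Rightarrow> 'r"

locale coalgebra = module R C for R (structure) and C (structure) +
  assumes comult_linear: "comult C \<in> linear_maps R C (tensor_product R C C)"
    and counit_linear: "counit C \<in> linear_maps R C (regular_module R)"
    and coassoc: "x \<in> carrier C \<Longrightarrow>
      tensor_assoc R C C C
        (tensor_map R (tensor_product R C C) C (comult C) (\<lambda>y. y) (comult C x)) =
      tensor_map R C (tensor_product R C C) (\<lambda>y. y) (comult C) (comult C x)"
    and counit_left: "x \<in> carrier C \<Longrightarrow>
      tensor_lift R C (\<lambda>y z. counit C y \<odot>\<^bsub>C\<^esub> z) (comult C x) = x"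
    and counit_right: "x \<in> carrier C \<Longrightarrow>
      tensor_lift R C (\<lambda>y z. counit C z \<odot>\<^bsub>C\<^esub> y) (comult C x) = x"

locale bialgebra = coalgebra R B + unital_algebra R B for R (structure) and B (structure) +
  assumes comult_ring_hom: "comult B \<in> ring_hom B (tensor_algebra R B B)"
    and counit_ring_hom: "counit B \<in> ring_hom B R"

definition antipode ::
  "('r, 'x) ring_scheme \<Rightarrow> ('r, 'b, 'y) coalgebra_scheme \<Rightarrow> ('b \<Rightarrow> 'b) \<Rightarrow> bool" where
  "antipode R B S \<longleftrightarrow> S \<in> linear_maps R B B \<and>
     (\<forall>x\<in>carrier B.
        tensor_lift R B (\<lambda>y z. S y \<otimes>\<^bsub>B\<^esub> z) (comult B x) = counit B x \<odot>\<^bsub>B\<^esub> \<one>\<^bsub>B\<^esub> \<and>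
        tensor_lift R B (\<lambda>y z. y \<otimes>\<^bsub>B\<^esub> S z) (comult B x) = counit B x \<odot>\<^bsub>B\<^esub> \<one>\<^bsub>B\<^esub>)"

definition hopf_algebra ::
  "('r, 'x) ring_scheme \<Rightarrow> ('r, 'b, 'y) coalgebra_scheme \<Rightarrow> bool" where
  "hopf_algebra R B \<longleftrightarrow> bialgebra R B \<and> (\<exists>S. antipode R B S)"

definition convolution_algebra ::
  "('r, 'x) ring_scheme \<Rightarrow> ('r, 'c, 'y) coalgebra_scheme \<Rightarrow> ('r, 'a, 'z) module_scheme \<Rightarrow>
   ('r, 'c \<Rightarrow> 'a) module"
  where
  "convolution_algebra R C A = (hom_module R C A)
     \<lparr>mult := (\<lambda>f g. \<lambda>x\<in>carrier C. tensor_lift R A (\<lambda>y z. f y \<otimes>\<^bsub>A\<^esub> g z) (comult C x)),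
      one := (\<lambda>x\<in>carrier C. counit C x \<odot>\<^bsub>A\<^esub> \<one>\<^bsub>A\<^esub>)\<rparr>"


section \<open>Grouplike elements and characters\<close>

definition sgpl :: "('r, 'x) ring_scheme \<Rightarrow> ('r, 'c, 'y) coalgebra_scheme \<Rightarrow> 'c set" where
  "sgpl R C = {g \<in> carrier C. comult C g = pure_tensor R C C g g \<and> g \<noteq> \<zero>\<^bsub>C\<^esub>}"

definition gpl :: "('r, 'x) ring_scheme \<Rightarrow> ('r, 'c, 'y) coalgebra_scheme \<Rightarrow> 'c set" where
  "gpl R C = {g \<in> carrier C. comult C g = pure_tensor R C C g g \<and> counit C g = \<one>\<^bsub>R\<^esub>}"

definition characters ::
  "('r, 'x) ring_scheme \<Rightarrow> ('r, 'b, 'y) coalgebra_scheme \<Rightarrow> ('r, 'a, 'z) module_scheme \<Rightarrow>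
   ('b \<Rightarrow> 'a) set"
  where
  "characters R B A = carrier (hom_module R B A) \<inter> ring_hom B A"

definition grouplike_invertible ::
  "('r, 'x) ring_scheme \<Rightarrow> ('r, 'c, 'y) coalgebra_scheme \<Rightarrow> ('r, 'a, 'z) module_scheme \<Rightarrow>
   ('c \<Rightarrow> 'a) \<Rightarrow> bool"
  where
  "grouplike_invertible R C A \<phi> \<longleftrightarrow> (\<forall>g\<in>gpl R C. \<phi> g \<in> Units A)"


section \<open>The bivariate Quillen filtration and pathlike coalgebras\<close>

definition cyclic_submodule ::
  "('r, 'x) ring_scheme \<Rightarrow> ('r, 'm, 'y) module_scheme \<Rightarrow> 'm \<Rightarrow> 'm set" where
  "cyclic_submodule R M x = (\<lambda>a. a \<odot>\<^bsub>M\<^esub> x) ` carrier R"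

definition box_tensor ::
  "('r, 'x) ring_scheme \<Rightarrow> ('r, 'c, 'y) module_scheme \<Rightarrow> 'c set \<Rightarrow> 'c set \<Rightarrow> ('c \<times> 'c \<Rightarrow> 'r) set set"
  where
  "box_tensor R C M N =
     finite_sums (tensor_product R C C) {pure_tensor R C C x y | x y. x \<in> M \<and> y \<in> N}"

definition reduced_comult ::
  "('r, 'x) ring_scheme \<Rightarrow> ('r, 'c, 'y) coalgebra_scheme \<Rightarrow> 'c \<Rightarrow> 'c \<Rightarrow> 'c \<Rightarrow> ('c \<times> 'c \<Rightarrow> 'r) set"
  where
  "reduced_comult R C g h x =
     comult C x \<ominus>\<^bsub>tensor_product R C C\<^esub> pure_tensor R C C g x
       \<ominus>\<^bsub>tensor_product R C C\<^esub> pure_tensor R C C x h"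

text \<open>The sum of a family of submodules consists of the finite sums of elements of their union.\<close>

primrec quillen ::
  "('r, 'x) ring_scheme \<Rightarrow> ('r, 'c, 'y) coalgebra_scheme \<Rightarrow> nat \<Rightarrow> 'c \<Rightarrow> 'c \<Rightarrow> 'c set" where
  "quillen R C 0 = (\<lambda>g h. cyclic_submodule R C g \<inter> cyclic_submodule R C h)"
| "quillen R C (Suc n) = (\<lambda>g h. {x \<in> carrier C.
     reduced_comult R C g h x \<in> finite_sums (tensor_product R C C)
       (\<Union>t\<in>sgpl R C. box_tensor R C (quillen R C n g t) (quillen R C n t h))})"

definition quillen_total ::
  "('r, 'x) ring_scheme \<Rightarrow> ('r, 'c, 'y) coalgebra_scheme \<Rightarrow> nat \<Rightarrow> 'c set" where
  "quillen_total R C n = finite_sums C (\<Union>g\<in>sgpl R C. \<Union>h\<in>sgpl R C. quillen R C n g h)"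

definition sg_flavored ::
  "('r, 'x) ring_scheme \<Rightarrow> ('r, 'c, 'y) coalgebra_scheme \<Rightarrow> bool" where
  "sg_flavored R C \<longleftrightarrow> carrier C = (\<Union>n. quillen_total R C n)"

text \<open>
  The last conjunct says that \<open>quillen_total R C 0\<close> is free with basis \<open>gpl R C\<close>: every element of
  it is a unique finite linear combination of grouplike elements, and all these lie in it.
\<close>

definition pathlike ::
  "('r, 'x) ring_scheme \<Rightarrow> ('r, 'c, 'y) coalgebra_scheme \<Rightarrow> bool" where
  "pathlike R C \<longleftrightarrow> coalgebra R C \<and> sg_flavored R C \<and> sgpl R C = gpl R C \<and>
     bij_betw (free_lift R C (\<lambda>g. g)) (carrier (free_module R (gpl R C))) (quillen_total R C 0)"

end

theory Submission
  imports Defs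
begin

text \<open>
  Call \<open>f\<close> invertible at \<open>x \<in> C\<close> if it is invertible modulo the largest two-sided ideal \<open>I\<^sub>x\<close> of
  the convolution algebra \<open>H\<close> whose elements vanish at \<open>x\<close>. If \<open>p\<close> inverts \<open>f\<close> modulo \<open>I\<^sub>x\<close> and
  \<open>q\<close> inverts \<open>f\<close> modulo \<open>I\<^sub>y\<close>, then \<open>p + q - p f q\<close> inverts \<open>f\<close> modulo both, because
  \<open>1 - f (p + q - p f q) = (1 - f p) (1 - f q)\<close>. Hence inverses exist modulo finite intersections,
  and these local inverses glue to an inverse of \<open>f\<close> in \<open>H\<close> as soon as \<open>f\<close> is invertible at
  every point.

  A grouplike \<open>g\<close> with \<open>f g\<close> a unit is such a point. Climbing the Quillen filtration, let
  \<open>\<Delta> x = g \<otimes> x + x \<otimes> h + \<Sum> y\<^sub>i \<otimes> z\<^sub>i\<close> with \<open>f\<close> invertible at \<open>g, h, y\<^sub>i, z\<^sub>i\<close>, and let \<open>J\<close> be the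
  intersection of the corresponding ideals. Then \<open>J\<^sup>2 \<subseteq> I\<^sub>x\<close>, and if \<open>p\<close> inverts \<open>f\<close> modulo \<open>J\<close>,
  then \<open>p + p - p f p\<close> inverts it modulo \<open>J\<^sup>2\<close>.

  For the Hopf algebra criterion this is applied to the identity map.
\<close>

section \<open>Finite sums\<close>

lemma (in abelian_monoid) finite_sums_zero: "\<zero>\<^bsub>G\<^esub> \<in> finite_sums G S"
  unfolding finite_sums_def by (auto intro!: exI[of _ "0::nat"] simp: finsum_empty)

lemma (in abelian_monoid) finite_sums_snoc:
  assumes "S \<subseteq> carrier G" "y \<in> finite_sums G S" "s \<in> S"
  shows "y \<oplus>\<^bsub>G\<^esub> s \<in> finite_sums G S"
proof -
  obtain n :: nat and f where f: "f \<in> {..<n} \<rightarrow> S" "y = finsum G f {..<n}"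
    using assms(2) by (auto simp: finite_sums_def)
  \<comment> \<open>The index \<open>n\<close> is the first one that the old sum does not use, so
    overwriting the family there leaves that sum unchanged.\<close>
  let ?f = "f(n := s)"
  have "?f \<in> {..<n} \<rightarrow> carrier G"
    using f assms by (auto simp: Pi_def)
  then have "finsum G ?f {..<Suc n} = s \<oplus>\<^bsub>G\<^esub> finsum G ?f {..<n}"
    using assms by (subst lessThan_Suc, subst finsum_insert) auto
  also have "finsum G ?f {..<n} = y"
    unfolding f(2) using f(1) assms by (intro finsum_cong') auto
  also have "s \<oplus>\<^bsub>G\<^esub> y = y \<oplus>\<^bsub>G\<^esub> s"
    using f assms by (auto intro!: a_comm finsum_closed)
  finally show ?thesis
    using f(1) assms(3) unfolding finite_sums_def
    by (auto intro!: exI[of _ "Suc n"] exI[of _ ?f] simp: Pi_def simp del: fun_upd_apply)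
      (auto simp: less_Suc_eq)
qed

text \<open>By induction on the number of summands, peeling off the last one. This rule carries
  properties from generators to the tensor kernel, to sums of box tensors and to the total Quillen
  filtration, without handling indexed families again.\<close>

lemma (in abelian_monoid) finite_sums_induct [consumes 2, case_names zero add]:
  assumes S: "S \<subseteq> carrier G" and "y \<in> finite_sums G S"
    and zero: "P \<zero>\<^bsub>G\<^esub>"
    and add: "\<And>y s. y \<in> finite_sums G S \<Longrightarrow> y \<in> carrier G \<Longrightarrow> P y \<Longrightarrow> s \<in> S \<Longrightarrow> P (y \<oplus>\<^bsub>G\<^esub> s)"
  shows "P y"
proof -
  obtain n :: nat and f where f: "f \<in> {..<n} \<rightarrow> S" and y: "y = finsum G f {..<n}"
    using assms(2) by (auto simp: finite_sums_def)
  from f have "P (finsum G f {..<n})"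
  proof (induction n)
    case 0
    then show ?case by (simp add: finsum_empty zero)
  next
    case (Suc n)
    have f: "f \<in> {..<n} \<rightarrow> S" "f n \<in> S"
      using Suc.prems by auto
    have c: "f \<in> {..<n} \<rightarrow> carrier G"
      using f S by auto
    have "finsum G f {..<n} \<in> finite_sums G S"
      using f by (auto simp: finite_sums_def)
    then have "P (finsum G f {..<n} \<oplus>\<^bsub>G\<^esub> f n)"
      using f c Suc.IH by (intro add) auto
    then show ?case
      using f c S by (subst lessThan_Suc, subst finsum_insert) (auto simp: a_comm)
  qed
  then show ?thesis using y by simp
qed

lemma (in abelian_monoid) finite_sums_closed:
  assumes "S \<subseteq> carrier G" "y \<in> finite_sums G S"
  shows "y \<in> carrier G"
  using assms(1,2) by (induction rule: finite_sums_induct) (use assms(1) in auto)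

lemma (in abelian_monoid) finite_sums_add:
  assumes S: "S \<subseteq> carrier G" and x: "x \<in> finite_sums G S" and y: "y \<in> finite_sums G S"
  shows "x \<oplus>\<^bsub>G\<^esub> y \<in> finite_sums G S"
  using S y
proof (induction rule: finite_sums_induct)
  case zero
  then show ?case using finite_sums_closed[OF S x] x by simp
next
  case (add y s)
  have "x \<oplus>\<^bsub>G\<^esub> (y \<oplus>\<^bsub>G\<^esub> s) = (x \<oplus>\<^bsub>G\<^esub> y) \<oplus>\<^bsub>G\<^esub> s"
    using finite_sums_closed[OF S x] add S by (auto simp: a_assoc)
  then show ?case
    using finite_sums_snoc[OF S add.IH add.hyps(3)] by simp
qed

lemma (in module) finite_sums_smult:
  assumes S: "S \<subseteq> carrier M" and y: "y \<in> finite_sums M S" and a: "a \<in> carrier R"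
    and smult: "\<And>s. s \<in> S \<Longrightarrow> a \<odot>\<^bsub>M\<^esub> s \<in> S"
  shows "a \<odot>\<^bsub>M\<^esub> y \<in> finite_sums M S"
  using S y
proof (induction rule: M.finite_sums_induct)
  case zero
  then show ?case using a by (simp add: M.finite_sums_zero)
next
  case (add y s)
  then show ?case
    using S a smult by (subst smult_r_distr) (auto intro!: M.finite_sums_snoc)
qed

text \<open>Negation is multiplication by the scalar \<open>\<ominus> \<one>\<close>, so a
  generating set closed under scalars already gives negatives.\<close>

lemma (in module) finite_sums_submodule:
  assumes S: "S \<subseteq> carrier M"
    and smult: "\<And>a s. a \<in> carrier R \<Longrightarrow> s \<in> S \<Longrightarrow> a \<odot>\<^bsub>M\<^esub> s \<in> S"
  shows "submodule (finite_sums M S) R M"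
proof (rule submoduleI)
  show "\<ominus>\<^bsub>M\<^esub> x \<in> finite_sums M S" if "x \<in> finite_sums M S" for x
  proof -
    have "\<ominus>\<^bsub>M\<^esub> x = (\<ominus>\<^bsub>R\<^esub> \<one>\<^bsub>R\<^esub>) \<odot>\<^bsub>M\<^esub> x"
      using M.finite_sums_closed[OF S that] by (simp add: smult_l_minus)
    also have "\<dots> \<in> finite_sums M S"
      using S that smult by (intro finite_sums_smult) auto
    finally show ?thesis .
  qed
qed (use S smult in \<open>auto intro: M.finite_sums_closed M.finite_sums_zero M.finite_sums_add
      finite_sums_smult\<close>)


section \<open>Linear maps and free modules\<close>

lemma linear_mapsI:
  assumes "\<And>x. x \<in> carrier M \<Longrightarrow> f x \<in> carrier N"
    and "\<And>x y. x \<in> carrier M \<Longrightarrow> y \<in> carrier M \<Longrightarrow> f (x \<oplus>\<^bsub>M\<^esub> y) = f x \<oplus>\<^bsub>N\<^esub> f y"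
    and "\<And>a x. a \<in> carrier R \<Longrightarrow> x \<in> carrier M \<Longrightarrow> f (a \<odot>\<^bsub>M\<^esub> x) = a \<odot>\<^bsub>N\<^esub> f x"
  shows "f \<in> linear_maps R M N"
  using assms by (auto simp: linear_maps_def)

lemma linear_mapsD:
  assumes "f \<in> linear_maps R M N"
  shows "x \<in> carrier M \<Longrightarrow> f x \<in> carrier N"
    and "x \<in> carrier M \<Longrightarrow> y \<in> carrier M \<Longrightarrow> f (x \<oplus>\<^bsub>M\<^esub> y) = f x \<oplus>\<^bsub>N\<^esub> f y"
    and "a \<in> carrier R \<Longrightarrow> x \<in> carrier M \<Longrightarrow> f (a \<odot>\<^bsub>M\<^esub> x) = a \<odot>\<^bsub>N\<^esub> f x"
  using assms by (auto simp: linear_maps_def)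

lemma linear_maps_group_hom:
  assumes "f \<in> linear_maps R M N" "abelian_group M" "abelian_group N"
  shows "abelian_group_hom M N f"
  using assms by (intro abelian_group_homI) (auto simp: linear_maps_def hom_def group_hom_def
      group_hom_axioms_def abelian_group.a_group)

lemma linear_maps_zero:
  assumes "f \<in> linear_maps R M N" "abelian_group M" "abelian_group N"
  shows "f \<zero>\<^bsub>M\<^esub> = \<zero>\<^bsub>N\<^esub>"
  using linear_maps_group_hom[OF assms] by (rule abelian_group_hom.hom_zero)

lemma linear_maps_minus:
  assumes f: "f \<in> linear_maps R M N" and M: "abelian_group M" and N: "abelian_group N"
    and x: "x \<in> carrier M" and y: "y \<in> carrier M"
  shows "f (x \<ominus>\<^bsub>M\<^esub> y) = f x \<ominus>\<^bsub>N\<^esub> f y"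
proof -
  interpret M: abelian_group M by fact
  interpret h: abelian_group_hom M N f
    by (rule linear_maps_group_hom[OF f M N])
  show ?thesis using x y by (simp add: a_minus_def)
qed

lemma linear_maps_compose:
  assumes "f \<in> linear_maps R M N" "g \<in> linear_maps R N P"
  shows "(\<lambda>x. g (f x)) \<in> linear_maps R M P"
  using assms unfolding linear_maps_def by (auto 0 3 simp: Pi_iff)

context
  fixes R :: "('r, 'x) ring_scheme" and I :: "'i set"
  assumes R: "cring R"
begin

interpretation R: cring R by (rule R)

lemma free_module_carrierD:
  assumes "c \<in> carrier (free_module R I)"
  shows "c i \<in> carrier R" "finite {i. c i \<noteq> \<zero>\<^bsub>R\<^esub>}" "{i. c i \<noteq> \<zero>\<^bsub>R\<^esub>} \<subseteq> I"
  using assms by (auto simp: free_module_def)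

lemma free_module_simps:
  "\<zero>\<^bsub>free_module R I\<^esub> = (\<lambda>i. \<zero>\<^bsub>R\<^esub>)"
  "c \<oplus>\<^bsub>free_module R I\<^esub> d = (\<lambda>i. c i \<oplus>\<^bsub>R\<^esub> d i)"
  "a \<odot>\<^bsub>free_module R I\<^esub> c = (\<lambda>i. a \<otimes>\<^bsub>R\<^esub> c i)"
  by (simp_all add: free_module_def)

lemma free_module_add_closed:
  assumes c: "c \<in> carrier (free_module R I)" and d: "d \<in> carrier (free_module R I)"
  shows "(\<lambda>i. c i \<oplus>\<^bsub>R\<^esub> d i) \<in> carrier (free_module R I)"
proof -
  note [simp] = free_module_carrierD(1)[OF c] free_module_carrierD(1)[OF d]
  have "{i. c i \<oplus>\<^bsub>R\<^esub> d i \<noteq> \<zero>\<^bsub>R\<^esub>} \<subseteq> {i. c i \<noteq> \<zero>\<^bsub>R\<^esub>} \<union> {i. d i \<noteq> \<zero>\<^bsub>R\<^esub>}"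
    by auto
  then show ?thesis
    using free_module_carrierD(2,3)[OF c] free_module_carrierD(2,3)[OF d]
    by (auto simp: free_module_def intro: finite_subset[OF _ finite_UnI])
qed

lemma free_module_smult_closed:
  assumes c: "c \<in> carrier (free_module R I)" and a: "a \<in> carrier R"
  shows "(\<lambda>i. a \<otimes>\<^bsub>R\<^esub> c i) \<in> carrier (free_module R I)"
proof -
  have "{i. a \<otimes>\<^bsub>R\<^esub> c i \<noteq> \<zero>\<^bsub>R\<^esub>} \<subseteq> {i. c i \<noteq> \<zero>\<^bsub>R\<^esub>}"
    using a by auto
  then show ?thesis
    using free_module_carrierD[OF c] a
    by (auto simp: free_module_def intro: finite_subset)
qed

lemma free_module_module: "module R (free_module R I)"
proof (rule moduleI)
  show "abelian_group (free_module R I)"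
  proof (rule abelian_groupI)
    fix c assume c: "c \<in> carrier (free_module R I)"
    note [simp] = free_module_carrierD(1)[OF c]
    \<comment> \<open>The additive inverse is taken as a scalar multiple of \<open>c\<close>, so its
      finite support comes from closure under scalars.\<close>
    have "(\<lambda>i. (\<ominus>\<^bsub>R\<^esub> \<one>\<^bsub>R\<^esub>) \<otimes>\<^bsub>R\<^esub> c i) \<in> carrier (free_module R I)"
      by (intro free_module_smult_closed c) simp
    moreover have "(\<ominus>\<^bsub>R\<^esub> \<one>\<^bsub>R\<^esub>) \<otimes>\<^bsub>R\<^esub> c i \<oplus>\<^bsub>R\<^esub> c i = \<zero>\<^bsub>R\<^esub>" for i
      by (simp add: R.l_minus R.l_neg)
    ultimately show "\<exists>d\<in>carrier (free_module R I). d \<oplus>\<^bsub>free_module R I\<^esub> c = \<zero>\<^bsub>free_module R I\<^esub>"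
      unfolding free_module_simps by (intro bexI[where x = "\<lambda>i. (\<ominus>\<^bsub>R\<^esub> \<one>\<^bsub>R\<^esub>) \<otimes>\<^bsub>R\<^esub> c i"]) auto
  qed (auto simp: free_module_simps free_module_add_closed free_module_carrierD(1)
      R.add.m_ac, auto simp: free_module_def)
qed (auto simp: free_module_simps free_module_smult_closed free_module_carrierD(1)
      R.l_distr R.r_distr R.m_assoc R)

lemma basis_vector_closed: "i \<in> I \<Longrightarrow> basis_vector R i \<in> carrier (free_module R I)"
  by (auto simp: free_module_def basis_vector_def)

text \<open>By induction on the finite support: the coordinate at one index is split off as a
  multiple of a basis vector.\<close>

lemma free_module_induct [consumes 1, case_names zero add]:
  assumes c: "c \<in> carrier (free_module R I)"
    and zero: "P \<zero>\<^bsub>free_module R I\<^esub>"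
    and add: "\<And>c a i. c \<in> carrier (free_module R I) \<Longrightarrow> P c \<Longrightarrow> a \<in> carrier R \<Longrightarrow> i \<in> I \<Longrightarrow>
      P (c \<oplus>\<^bsub>free_module R I\<^esub> a \<odot>\<^bsub>free_module R I\<^esub> basis_vector R i)"
  shows "P c"
proof -
  have "finite {i. c i \<noteq> \<zero>\<^bsub>R\<^esub>}" using free_module_carrierD[OF c] by simp
  then show ?thesis using c
  proof (induction "{i. c i \<noteq> \<zero>\<^bsub>R\<^esub>}" arbitrary: c rule: finite_induct)
    case empty
    then have "c = \<zero>\<^bsub>free_module R I\<^esub>" by (auto simp: free_module_simps)
    then show ?case using zero by simp
  next
    case (insert i J)
    note c = free_module_carrierD[OF insert.prems]
    \<comment> \<open>Zeroing the coordinate \<open>i\<close> removes exactly \<open>i\<close> from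
      the support, which leaves the set \<open>J\<close> of the induction hypothesis.\<close>
    define d where "d = c(i := \<zero>\<^bsub>R\<^esub>)"
    have J: "J = {j. d j \<noteq> \<zero>\<^bsub>R\<^esub>}"
      using insert.hyps(2,4) by (auto simp: d_def)
    have i: "i \<in> I" using insert.hyps(4) c(3) by auto
    have d: "d \<in> carrier (free_module R I)"
      using c insert.hyps(1) J by (auto simp: free_module_def d_def)
    have eq: "c = d \<oplus>\<^bsub>free_module R I\<^esub> c i \<odot>\<^bsub>free_module R I\<^esub> basis_vector R i"
      using c(1) by (auto simp: d_def free_module_simps basis_vector_def)
    show ?case
      by (subst eq) (rule add[OF d insert.hyps(3)[OF J d] c(1) i])
  qed
qed

end

context
  fixes R :: "('r, 'x) ring_scheme" and M :: "('r, 'm, 'y) module_scheme"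
    and I :: "'i set" and v :: "'i \<Rightarrow> 'm"
  assumes M: "module R M" and v: "v \<in> I \<rightarrow> carrier M"
begin

interpretation M: module R M by (rule M)

text \<open>Indices outside the support contribute zero. Enlarging the index set in this way lets
  vectors with different supports be summed over one common set.\<close>

lemma free_lift_eq_finsum:
  assumes c: "c \<in> carrier (free_module R I)"
    and J: "finite J" "J \<subseteq> I" "{i. c i \<noteq> \<zero>\<^bsub>R\<^esub>} \<subseteq> J"
  shows "free_lift R M v c = finsum M (\<lambda>i. c i \<odot>\<^bsub>M\<^esub> v i) J"
  unfolding free_lift_def
  using J v free_module_carrierD[OF M.R.is_cring c]
  by (intro M.add.finprod_mono_neutral_cong_left) (auto simp: Pi_def subset_eq)

lemma free_lift_closed:
  assumes c: "c \<in> carrier (free_module R I)"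
  shows "free_lift R M v c \<in> carrier M"
  unfolding free_lift_def using v free_module_carrierD[OF M.R.is_cring c]
  by (intro M.M.finsum_closed) (auto simp: Pi_def subset_eq)

lemma free_lift_linear: "free_lift R M v \<in> linear_maps R (free_module R I) M"
proof (rule linear_mapsI)
  let ?F = "free_module R I"
  fix c assume c: "c \<in> carrier ?F"
  note c' = free_module_carrierD[OF M.R.is_cring c]
  show "free_lift R M v c \<in> carrier M" by (rule free_lift_closed[OF c])
  {
    fix d assume d: "d \<in> carrier ?F"
    note d' = free_module_carrierD[OF M.R.is_cring d]
    let ?J = "{i. c i \<noteq> \<zero>\<^bsub>R\<^esub>} \<union> {i. d i \<noteq> \<zero>\<^bsub>R\<^esub>}"
    have cv: "(\<lambda>i. c i \<odot>\<^bsub>M\<^esub> v i) \<in> ?J \<rightarrow> carrier M" "(\<lambda>i. d i \<odot>\<^bsub>M\<^esub> v i) \<in> ?J \<rightarrow> carrier M"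
      using v c' d' by (auto simp: Pi_def subset_eq)
    have "free_lift R M v (c \<oplus>\<^bsub>?F\<^esub> d) = finsum M (\<lambda>i. (c \<oplus>\<^bsub>?F\<^esub> d) i \<odot>\<^bsub>M\<^esub> v i) ?J"
      using c' d' c d free_module_add_closed[OF M.R.is_cring c d]
      by (intro free_lift_eq_finsum) (auto simp: free_module_simps[OF M.R.is_cring])
    also have "\<dots> = finsum M (\<lambda>i. c i \<odot>\<^bsub>M\<^esub> v i \<oplus>\<^bsub>M\<^esub> d i \<odot>\<^bsub>M\<^esub> v i) ?J"
      using v c' d' by (intro M.M.finsum_cong')
        (auto simp: Pi_def subset_eq free_module_simps[OF M.R.is_cring] M.smult_l_distr)
    also have "\<dots> = free_lift R M v c \<oplus>\<^bsub>M\<^esub> free_lift R M v d"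
      using c' d' c d cv
      by (subst M.M.finsum_addf) (auto simp: free_lift_eq_finsum[of _ ?J])
    finally show "free_lift R M v (c \<oplus>\<^bsub>?F\<^esub> d) = free_lift R M v c \<oplus>\<^bsub>M\<^esub> free_lift R M v d" .
  }
  fix a assume a: "a \<in> carrier R"
  let ?J = "{i. c i \<noteq> \<zero>\<^bsub>R\<^esub>}"
  have "free_lift R M v (a \<odot>\<^bsub>?F\<^esub> c) = finsum M (\<lambda>i. (a \<odot>\<^bsub>?F\<^esub> c) i \<odot>\<^bsub>M\<^esub> v i) ?J"
    using c' a c free_module_smult_closed[OF M.R.is_cring c a]
    by (intro free_lift_eq_finsum) (auto simp: free_module_simps[OF M.R.is_cring])
  also have "\<dots> = finsum M (\<lambda>i. a \<odot>\<^bsub>M\<^esub> (c i \<odot>\<^bsub>M\<^esub> v i)) ?J"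
    using v c' a by (intro M.M.finsum_cong')
      (auto simp: Pi_def subset_eq free_module_simps[OF M.R.is_cring] M.smult_assoc1)
  also have "\<dots> = a \<odot>\<^bsub>M\<^esub> free_lift R M v c"
    unfolding free_lift_def using c' a v
    by (intro M.finsum_smult_ldistr[symmetric]) (auto simp: Pi_def subset_eq)
  finally show "free_lift R M v (a \<odot>\<^bsub>?F\<^esub> c) = a \<odot>\<^bsub>M\<^esub> free_lift R M v c" .
qed

lemma free_lift_basis_vector:
  assumes i: "i \<in> I"
  shows "free_lift R M v (basis_vector R i) = v i"
proof -
  have "free_lift R M v (basis_vector R i) = finsum M (\<lambda>j. basis_vector R i j \<odot>\<^bsub>M\<^esub> v j) {i}"
    using i basis_vector_closed[OF M.R.is_cring i]
    by (intro free_lift_eq_finsum) (auto simp: basis_vector_def)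
  then show ?thesis
    using i v by (auto simp: basis_vector_def Pi_def)
qed

end

section \<open>Quotient modules and tensor products\<close>

text \<open>The module laws are equations, and existence of negatives has a witness, so everything
  transports along a surjection that respects the operations. For quotients this avoids calculating
  with cosets as sets.\<close>

lemma module_image:
  assumes M: "module R M"
    and carr: "carrier Q = q ` carrier M" and zero: "\<zero>\<^bsub>Q\<^esub> = q \<zero>\<^bsub>M\<^esub>"
    and q: "q \<in> linear_maps R M Q"
  shows "module R Q"
proof -
  interpret M: module R M by (rule M)
  have [simp]: "q x \<oplus>\<^bsub>Q\<^esub> q y = q (x \<oplus>\<^bsub>M\<^esub> y)" if "x \<in> carrier M" "y \<in> carrier M" for x y
    using linear_mapsD(2)[OF q that] by simp
  have [simp]: "a \<odot>\<^bsub>Q\<^esub> q x = q (a \<odot>\<^bsub>M\<^esub> x)" if "a \<in> carrier R" "x \<in> carrier M" for a x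
    using linear_mapsD(3)[OF q that] by simp
  show ?thesis
  proof (rule moduleI)
    show "abelian_group Q"
    proof (rule abelian_groupI)
      fix X assume "X \<in> carrier Q"
      then obtain x where x: "x \<in> carrier M" "X = q x" by (auto simp: carr)
      then have "q (\<ominus>\<^bsub>M\<^esub> x) \<oplus>\<^bsub>Q\<^esub> X = \<zero>\<^bsub>Q\<^esub>"
        by (simp add: zero M.M.l_neg)
      then show "\<exists>Y\<in>carrier Q. Y \<oplus>\<^bsub>Q\<^esub> X = \<zero>\<^bsub>Q\<^esub>"
        using x by (auto simp: carr)
    qed (auto simp: carr zero M.M.add.m_ac)
  qed (auto simp: carr M.smult_l_distr M.smult_r_distr M.smult_assoc1 intro: M.R.is_cring)
qed

context
  fixes R :: "('r, 'x) ring_scheme" and M :: "('r, 'm, 'y) module_scheme" and N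
  assumes M: "module R M" and N: "submodule N R M"
begin

interpretation M: module R M by (rule M)

lemma submodule_abelian_subgroup: "abelian_subgroup N M"
  using N by (intro abelian_subgroupI3 additive_subgroupI M.M.abelian_group_axioms)
    (rule submodule.axioms(1))

interpretation N: abelian_subgroup N M by (rule submodule_abelian_subgroup)

lemma quotient_module_carrier:
  "carrier (quotient_module M N) = (\<lambda>x. N +>\<^bsub>M\<^esub> x) ` carrier M"
  by (auto simp: quotient_module_def A_RCOSETS_def')

lemma quotient_map_linear: "(\<lambda>x. N +>\<^bsub>M\<^esub> x) \<in> linear_maps R M (quotient_module M N)"
proof (rule linear_mapsI)
  fix a x assume a: "a \<in> carrier R" and x: "x \<in> carrier M"
  \<comment> \<open>Scaling a coset elementwise may give less than a coset; adding \<open>N\<close>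
    fills it up. One inclusion absorbs the scaled elements of \<open>N\<close> into
    \<open>N\<close>, the other uses the representative \<open>x\<close> itself.\<close>
  have "N <+>\<^bsub>M\<^esub> (\<lambda>x. a \<odot>\<^bsub>M\<^esub> x) ` (N +>\<^bsub>M\<^esub> x) = N +>\<^bsub>M\<^esub> (a \<odot>\<^bsub>M\<^esub> x)"
  proof (intro equalityI subsetI)
    fix z assume "z \<in> N <+>\<^bsub>M\<^esub> (\<lambda>x. a \<odot>\<^bsub>M\<^esub> x) ` (N +>\<^bsub>M\<^esub> x)"
    then obtain n n' where n: "n \<in> N" "n' \<in> N" "z = n \<oplus>\<^bsub>M\<^esub> a \<odot>\<^bsub>M\<^esub> (n' \<oplus>\<^bsub>M\<^esub> x)"
      by (auto simp: set_add_def' a_r_coset_def')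
    then have "z = (n \<oplus>\<^bsub>M\<^esub> a \<odot>\<^bsub>M\<^esub> n') \<oplus>\<^bsub>M\<^esub> a \<odot>\<^bsub>M\<^esub> x"
      using a x by (simp add: M.smult_r_distr M.M.add.m_assoc)
    moreover have "n \<oplus>\<^bsub>M\<^esub> a \<odot>\<^bsub>M\<^esub> n' \<in> N"
      using n a submodule.smult_closed[OF N] by auto
    ultimately show "z \<in> N +>\<^bsub>M\<^esub> (a \<odot>\<^bsub>M\<^esub> x)"
      by (auto simp: a_r_coset_def')
  next
    fix z assume "z \<in> N +>\<^bsub>M\<^esub> (a \<odot>\<^bsub>M\<^esub> x)"
    then obtain n where n: "n \<in> N" "z = n \<oplus>\<^bsub>M\<^esub> a \<odot>\<^bsub>M\<^esub> x"
      by (auto simp: a_r_coset_def')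
    moreover have "x \<in> N +>\<^bsub>M\<^esub> x"
      using x by (rule N.a_rcos_self)
    ultimately show "z \<in> N <+>\<^bsub>M\<^esub> (\<lambda>x. a \<odot>\<^bsub>M\<^esub> x) ` (N +>\<^bsub>M\<^esub> x)"
      by (auto simp: set_add_def')
  qed
  then show "N +>\<^bsub>M\<^esub> (a \<odot>\<^bsub>M\<^esub> x) = a \<odot>\<^bsub>quotient_module M N\<^esub> (N +>\<^bsub>M\<^esub> x)"
    by (simp add: quotient_module_def)
qed (auto simp: quotient_module_carrier, auto simp: quotient_module_def N.a_rcos_sum)

lemma quotient_module_module: "module R (quotient_module M N)"
proof (rule module_image[OF M _ _ quotient_map_linear])
  show "\<zero>\<^bsub>quotient_module M N\<^esub> = N +>\<^bsub>M\<^esub> \<zero>\<^bsub>M\<^esub>"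
    using N.a_subset by (simp add: quotient_module_def)
qed (rule quotient_module_carrier)

lemma quotient_map_eqI:
  assumes "x \<in> carrier M" "y \<in> carrier M" "x \<ominus>\<^bsub>M\<^esub> y \<in> N"
  shows "N +>\<^bsub>M\<^esub> x = N +>\<^bsub>M\<^esub> y"
  using assms N.a_rcos_module_rev[of y x] N.a_repr_independence'[of x y]
  by (simp add: a_minus_def)

end

definition bilinear ::
  "('r, 'x) ring_scheme \<Rightarrow> ('r, 'm, 'y) module_scheme \<Rightarrow> ('r, 'n, 'z) module_scheme \<Rightarrow>
   ('r, 'p, 'w) module_scheme \<Rightarrow> ('m \<Rightarrow> 'n \<Rightarrow> 'p) \<Rightarrow> bool"
  where
  "bilinear R M N P \<beta> \<longleftrightarrow> (\<forall>x\<in>carrier M. \<beta> x \<in> linear_maps R N P) \<and>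
     (\<forall>y\<in>carrier N. (\<lambda>x. \<beta> x y) \<in> linear_maps R M P)"

lemma bilinearI:
  assumes "\<And>x. x \<in> carrier M \<Longrightarrow> \<beta> x \<in> linear_maps R N P"
    and "\<And>y. y \<in> carrier N \<Longrightarrow> (\<lambda>x. \<beta> x y) \<in> linear_maps R M P"
  shows "bilinear R M N P \<beta>"
  using assms by (auto simp: bilinear_def)

lemma bilinearD:
  assumes "bilinear R M N P \<beta>"
  shows "x \<in> carrier M \<Longrightarrow> y \<in> carrier N \<Longrightarrow> \<beta> x y \<in> carrier P"
    and "x \<in> carrier M \<Longrightarrow> x' \<in> carrier M \<Longrightarrow> y \<in> carrier N \<Longrightarrow>
      \<beta> (x \<oplus>\<^bsub>M\<^esub> x') y = \<beta> x y \<oplus>\<^bsub>P\<^esub> \<beta> x' y"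
    and "x \<in> carrier M \<Longrightarrow> y \<in> carrier N \<Longrightarrow> y' \<in> carrier N \<Longrightarrow>
      \<beta> x (y \<oplus>\<^bsub>N\<^esub> y') = \<beta> x y \<oplus>\<^bsub>P\<^esub> \<beta> x y'"
    and "a \<in> carrier R \<Longrightarrow> x \<in> carrier M \<Longrightarrow> y \<in> carrier N \<Longrightarrow> \<beta> (a \<odot>\<^bsub>M\<^esub> x) y = a \<odot>\<^bsub>P\<^esub> \<beta> x y"
    and "a \<in> carrier R \<Longrightarrow> x \<in> carrier M \<Longrightarrow> y \<in> carrier N \<Longrightarrow> \<beta> x (a \<odot>\<^bsub>N\<^esub> y) = a \<odot>\<^bsub>P\<^esub> \<beta> x y"
  using assms by (auto simp: bilinear_def linear_maps_def Pi_iff)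

lemma bilinear_compose:
  assumes "bilinear R M N P \<beta>" "f \<in> linear_maps R M' M" "g \<in> linear_maps R N' N"
    and "h \<in> linear_maps R P Q"
  shows "bilinear R M' N' Q (\<lambda>x y. h (\<beta> (f x) (g y)))"
  using assms bilinearD[OF assms(1)] linear_mapsD[OF assms(2)] linear_mapsD[OF assms(3)]
    linear_mapsD[OF assms(4)]
  by (intro bilinearI linear_mapsI) simp_all

section \<open>The tensor product of two modules and its universal property\<close>

locale module_pair = M: module R M + N: module R N
  for R :: "('r, 'x) ring_scheme" and M :: "('r, 'm, 'y) module_scheme"
    and N :: "('r, 'n, 'z) module_scheme"
begin

abbreviation "FR \<equiv> free_module R (carrier M \<times> carrier N)"
abbreviation "TP \<equiv> tensor_product R M N"
abbreviation "KER \<equiv> tensor_kernel R M N"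

interpretation F: module R FR
  by (rule free_module_module) (rule M.R.is_cring)

lemma bilinear_relations_closed: "bilinear_relations R M N \<subseteq> carrier FR"
  unfolding bilinear_relations_def Let_def
  by (auto intro!: F.minus_closed F.M.minus_closed basis_vector_closed[OF M.R.is_cring] F.smult_closed)

lemma tensor_kernel_submodule: "submodule KER R FR"
  unfolding tensor_kernel_def Let_def
proof (rule F.finite_sums_submodule)
  show "{a \<odot>\<^bsub>FR\<^esub> r |a r. a \<in> carrier R \<and> r \<in> bilinear_relations R M N} \<subseteq> carrier FR"
    using bilinear_relations_closed by auto
  fix b s assume b: "b \<in> carrier R"
    and "s \<in> {a \<odot>\<^bsub>FR\<^esub> r |a r. a \<in> carrier R \<and> r \<in> bilinear_relations R M N}"
  then obtain a r where ar: "a \<in> carrier R" "r \<in> bilinear_relations R M N" "s = a \<odot>\<^bsub>FR\<^esub> r"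
    by auto
  then have "b \<odot>\<^bsub>FR\<^esub> s = (b \<otimes>\<^bsub>R\<^esub> a) \<odot>\<^bsub>FR\<^esub> r"
    using b bilinear_relations_closed by (simp add: F.smult_assoc1 subset_eq)
  then show "b \<odot>\<^bsub>FR\<^esub> s \<in> {a \<odot>\<^bsub>FR\<^esub> r |a r. a \<in> carrier R \<and> r \<in> bilinear_relations R M N}"
    using ar b by (auto intro!: exI[of _ "b \<otimes>\<^bsub>R\<^esub> a"] exI[of _ r])
qed

lemma bilinear_relations_subset_kernel: "bilinear_relations R M N \<subseteq> KER"
proof
  fix r assume r: "r \<in> bilinear_relations R M N"
  let ?S = "{a \<odot>\<^bsub>FR\<^esub> r |a r. a \<in> carrier R \<and> r \<in> bilinear_relations R M N}"
  have S: "?S \<subseteq> carrier FR"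
    using bilinear_relations_closed by auto
  have r': "r \<in> carrier FR"
    using r bilinear_relations_closed by auto
  have "r \<in> ?S"
    using r r' by (auto intro!: exI[of _ "\<one>\<^bsub>R\<^esub>"] exI[of _ r])
  from F.M.finite_sums_snoc[OF S F.M.finite_sums_zero this]
  show "r \<in> KER"
    using r' by (simp add: tensor_kernel_def Let_def)
qed

lemma tensor_module: "module R TP"
  unfolding tensor_product_def
  by (rule quotient_module_module[OF F.module_axioms tensor_kernel_submodule])

sublocale T: module R TP
  by (rule tensor_module)

lemma tensor_quotient_map_linear: "(\<lambda>c. KER +>\<^bsub>FR\<^esub> c) \<in> linear_maps R FR TP"
  unfolding tensor_product_def
  by (rule quotient_map_linear[OF F.module_axioms tensor_kernel_submodule])

lemma tensor_carrier: "carrier TP = (\<lambda>c. KER +>\<^bsub>FR\<^esub> c) ` carrier FR"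
  unfolding tensor_product_def
  by (rule quotient_module_carrier[OF F.module_axioms tensor_kernel_submodule])

text \<open>Each bilinearity law expresses that one of the four families in
  \<open>bilinear_relations\<close> becomes zero in the quotient; compatibility of the coset map
  with sums and scalars then rewrites the cosets as tensors.\<close>

lemma pure_tensor_bilinear: "bilinear R M N TP (pure_tensor R M N)"
proof -
  let ?e = "\<lambda>x y. basis_vector R (x, y)"
  have e: "?e x y \<in> carrier FR" if "x \<in> carrier M" "y \<in> carrier N" for x y
    using that by (intro basis_vector_closed M.R.is_cring) auto
  note q = linear_mapsD[OF tensor_quotient_map_linear]
  have eq: "KER +>\<^bsub>FR\<^esub> u = KER +>\<^bsub>FR\<^esub> v"
    if "u \<in> carrier FR" "v \<in> carrier FR" "u \<ominus>\<^bsub>FR\<^esub> v \<in> bilinear_relations R M N" for u v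
    using that bilinear_relations_subset_kernel
    by (intro quotient_map_eqI[OF F.module_axioms tensor_kernel_submodule]) auto
  have 1: "pure_tensor R M N x y \<in> carrier TP" if "x \<in> carrier M" "y \<in> carrier N" for x y
    using that by (auto simp: pure_tensor_def intro!: q e)
  have 2: "pure_tensor R M N (x \<oplus>\<^bsub>M\<^esub> x') y = pure_tensor R M N x y \<oplus>\<^bsub>TP\<^esub> pure_tensor R M N x' y"
    if "x \<in> carrier M" "x' \<in> carrier M" "y \<in> carrier N" for x x' y
  proof -
    have "basis_vector R (x \<oplus>\<^bsub>M\<^esub> x', y) \<ominus>\<^bsub>FR\<^esub> (?e x y \<oplus>\<^bsub>FR\<^esub> ?e x' y) \<in> bilinear_relations R M N"
      using that unfolding bilinear_relations_def Let_def by blast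
    then have "KER +>\<^bsub>FR\<^esub> basis_vector R (x \<oplus>\<^bsub>M\<^esub> x', y) = KER +>\<^bsub>FR\<^esub> ((?e x y \<oplus>\<^bsub>FR\<^esub> ?e x' y))"
      using that e by (intro eq) simp_all
    then show ?thesis
      using that e by (simp add: pure_tensor_def q(2))
  qed
  have 3: "pure_tensor R M N x (y \<oplus>\<^bsub>N\<^esub> y') = pure_tensor R M N x y \<oplus>\<^bsub>TP\<^esub> pure_tensor R M N x y'"
    if "x \<in> carrier M" "y \<in> carrier N" "y' \<in> carrier N" for x y y'
  proof -
    have "basis_vector R (x, y \<oplus>\<^bsub>N\<^esub> y') \<ominus>\<^bsub>FR\<^esub> (?e x y \<oplus>\<^bsub>FR\<^esub> ?e x y') \<in> bilinear_relations R M N"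
      using that unfolding bilinear_relations_def Let_def by blast
    then have "KER +>\<^bsub>FR\<^esub> basis_vector R (x, y \<oplus>\<^bsub>N\<^esub> y') = KER +>\<^bsub>FR\<^esub> ((?e x y \<oplus>\<^bsub>FR\<^esub> ?e x y'))"
      using that e by (intro eq) simp_all
    then show ?thesis
      using that e by (simp add: pure_tensor_def q(2))
  qed
  have 4: "pure_tensor R M N (a \<odot>\<^bsub>M\<^esub> x) y = a \<odot>\<^bsub>TP\<^esub> pure_tensor R M N x y"
    if "a \<in> carrier R" "x \<in> carrier M" "y \<in> carrier N" for a x y
  proof -
    have "basis_vector R (a \<odot>\<^bsub>M\<^esub> x, y) \<ominus>\<^bsub>FR\<^esub> a \<odot>\<^bsub>FR\<^esub> ?e x y \<in> bilinear_relations R M N"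
      using that unfolding bilinear_relations_def Let_def by blast
    then have "KER +>\<^bsub>FR\<^esub> basis_vector R (a \<odot>\<^bsub>M\<^esub> x, y) = KER +>\<^bsub>FR\<^esub> (a \<odot>\<^bsub>FR\<^esub> ?e x y)"
      using that e by (intro eq) simp_all
    then show ?thesis
      using that e by (simp add: pure_tensor_def q(3))
  qed
  have 5: "pure_tensor R M N x (a \<odot>\<^bsub>N\<^esub> y) = a \<odot>\<^bsub>TP\<^esub> pure_tensor R M N x y"
    if "a \<in> carrier R" "x \<in> carrier M" "y \<in> carrier N" for a x y
  proof -
    have "basis_vector R (x, a \<odot>\<^bsub>N\<^esub> y) \<ominus>\<^bsub>FR\<^esub> a \<odot>\<^bsub>FR\<^esub> ?e x y \<in> bilinear_relations R M N"
      using that unfolding bilinear_relations_def Let_def by blast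
    then have "KER +>\<^bsub>FR\<^esub> basis_vector R (x, a \<odot>\<^bsub>N\<^esub> y) = KER +>\<^bsub>FR\<^esub> (a \<odot>\<^bsub>FR\<^esub> ?e x y)"
      using that e by (intro eq) simp_all
    then show ?thesis
      using that e by (simp add: pure_tensor_def q(3))
  qed
  show ?thesis
    using 1 2 3 4 5 by (intro bilinearI linear_mapsI)
qed

lemmas pure_tensor_simps = bilinearD(2-5)[OF pure_tensor_bilinear]

lemma pure_tensor_closed [intro, simp]:
  "x \<in> carrier M \<Longrightarrow> y \<in> carrier N \<Longrightarrow> pure_tensor R M N x y \<in> carrier TP"
  by (rule bilinearD(1)[OF pure_tensor_bilinear])

text \<open>Every tensor is the coset of a formal sum. A coefficient is absorbed into the first
  factor and zero is itself the pure tensor of zeros, so pure tensors and sums are the only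
  cases.\<close>

lemma tensor_induct [consumes 1, case_names pure add]:
  assumes t: "t \<in> carrier TP"
    and pure: "\<And>x y. x \<in> carrier M \<Longrightarrow> y \<in> carrier N \<Longrightarrow> P (pure_tensor R M N x y)"
    and add: "\<And>s t. s \<in> carrier TP \<Longrightarrow> P s \<Longrightarrow> t \<in> carrier TP \<Longrightarrow> P t \<Longrightarrow> P (s \<oplus>\<^bsub>TP\<^esub> t)"
  shows "P t"
proof -
  note q = linear_mapsD[OF tensor_quotient_map_linear]
  have pure_zero: "pure_tensor R M N \<zero>\<^bsub>M\<^esub> \<zero>\<^bsub>N\<^esub> = \<zero>\<^bsub>TP\<^esub>"
    using pure_tensor_simps(3)[of "\<zero>\<^bsub>R\<^esub>" "\<zero>\<^bsub>M\<^esub>" "\<zero>\<^bsub>N\<^esub>"] by simp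
  obtain c where c: "c \<in> carrier FR" and t_eq: "t = KER +>\<^bsub>FR\<^esub> c"
    using t by (auto simp: tensor_carrier)
  have "P (KER +>\<^bsub>FR\<^esub> c)"
    using c
  proof (induction rule: free_module_induct[OF M.R.is_cring, consumes 1, case_names zero add])
    case zero
    have "KER +>\<^bsub>FR\<^esub> \<zero>\<^bsub>FR\<^esub> = \<zero>\<^bsub>TP\<^esub>"
      by (rule linear_maps_zero[OF tensor_quotient_map_linear]) unfold_locales
    then show ?case
      using pure[of "\<zero>\<^bsub>M\<^esub>" "\<zero>\<^bsub>N\<^esub>"] pure_zero by simp
  next
    case (add c a i)
    obtain x y where i: "i = (x, y)" "x \<in> carrier M" "y \<in> carrier N"
      using add.hyps by auto
    have e: "basis_vector R i \<in> carrier FR"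
      using add.hyps by (intro basis_vector_closed M.R.is_cring)
    have "KER +>\<^bsub>FR\<^esub> (a \<odot>\<^bsub>FR\<^esub> basis_vector R i) = pure_tensor R M N (a \<odot>\<^bsub>M\<^esub> x) y"
      using i e add.hyps by (subst q(3)) (simp_all add: pure_tensor_simps, simp add: pure_tensor_def)
    then have "P (KER +>\<^bsub>FR\<^esub> (a \<odot>\<^bsub>FR\<^esub> basis_vector R i))"
      using pure[of "a \<odot>\<^bsub>M\<^esub> x" y] i add.hyps by simp
    then show ?case
      using add.hyps add.IH e by (subst q(2)) (auto intro!: assms(3) q(1))
  qed
  then show ?thesis by (simp add: t_eq)
qed

text \<open>The uniqueness half of the universal property. Through it, identities between maps out
  of a tensor product are checked on pure tensors only.\<close>

lemma tensor_linear_eqI: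
  assumes P: "abelian_monoid P"
    and f: "f \<in> linear_maps R TP P" and g: "g \<in> linear_maps R TP P"
    and eq: "\<And>x y. x \<in> carrier M \<Longrightarrow> y \<in> carrier N \<Longrightarrow>
      f (pure_tensor R M N x y) = g (pure_tensor R M N x y)"
    and t: "t \<in> carrier TP"
  shows "f t = g t"
  using t by (induction rule: tensor_induct)
    (simp_all add: eq linear_mapsD(2)[OF f] linear_mapsD(2)[OF g])

context
  fixes P :: "('r, 'p, 'w) module_scheme" and \<beta> :: "'m \<Rightarrow> 'n \<Rightarrow> 'p"
  assumes P: "module R P" and \<beta>: "bilinear R M N P \<beta>"
begin

interpretation P: module R P by (rule P)

lemma bilinear_family: "(\<lambda>(x, y). \<beta> x y) \<in> carrier M \<times> carrier N \<rightarrow> carrier P"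
  using bilinearD(1)[OF \<beta>] by auto

text \<open>Bilinearity of \<open>\<beta>\<close> sends each relation to zero, and linearity extends
  this to sums of multiples of relations.\<close>

lemma free_lift_tensor_kernel:
  assumes k: "k \<in> KER"
  shows "free_lift R P (\<lambda>(x, y). \<beta> x y) k = \<zero>\<^bsub>P\<^esub>"
proof -
  let ?L = "free_lift R P (\<lambda>(x, y). \<beta> x y)"
  let ?S = "{a \<odot>\<^bsub>FR\<^esub> r |a r. a \<in> carrier R \<and> r \<in> bilinear_relations R M N}"
  note L = free_lift_linear[OF P bilinear_family]
  note e = basis_vector_closed[OF M.R.is_cring]
  have minus: "?L (u \<ominus>\<^bsub>FR\<^esub> v) = ?L u \<ominus>\<^bsub>P\<^esub> ?L v" if "u \<in> carrier FR" "v \<in> carrier FR" for u v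
    by (rule linear_maps_minus[OF L F.M.abelian_group_axioms P.M.abelian_group_axioms that])
  have Le: "?L (basis_vector R (x, y)) = \<beta> x y" if "x \<in> carrier M" "y \<in> carrier N" for x y
    using free_lift_basis_vector[OF P bilinear_family] that by auto
  note simps = minus Le linear_mapsD(2,3)[OF L] bilinearD[OF \<beta>] P.M.r_neg a_minus_def[of P] e
    F.M.minus_closed
  have rel: "?L r = \<zero>\<^bsub>P\<^esub>" if "r \<in> bilinear_relations R M N" for r
    using that unfolding bilinear_relations_def Let_def by (auto simp: simps)
  have "?S \<subseteq> carrier FR"
    using bilinear_relations_closed by auto
  moreover have "k \<in> finite_sums FR ?S"
    using k by (simp add: tensor_kernel_def Let_def)
  ultimately show ?thesis
  proof (induction rule: F.M.finite_sums_induct)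
    case zero
    show ?case by (rule linear_maps_zero[OF L]) unfold_locales
  next
    case (add y s)
    then obtain a r where "a \<in> carrier R" "r \<in> bilinear_relations R M N" "s = a \<odot>\<^bsub>FR\<^esub> r"
      by auto
    then show ?case
      using add bilinear_relations_closed by (auto simp: linear_mapsD(2,3)[OF L] rel subset_eq)
  qed
qed

text \<open>Members of a coset differ by elements of the kernel, where the lift vanishes. Hence the
  image under \<open>the_elem\<close> in \<open>tensor_lift\<close> is a singleton, and any
  representative may be used for evaluation.\<close>

lemma tensor_lift_coset:
  assumes c: "c \<in> carrier FR"
  shows "tensor_lift R P \<beta> (KER +>\<^bsub>FR\<^esub> c) = free_lift R P (\<lambda>(x, y). \<beta> x y) c"
proof -
  let ?L = "free_lift R P (\<lambda>(x, y). \<beta> x y)"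
  interpret K: abelian_subgroup KER FR
    by (rule submodule_abelian_subgroup[OF F.module_axioms tensor_kernel_submodule])
  note L = free_lift_linear[OF P bilinear_family]
  have "?L d = ?L c" if d: "d \<in> KER +>\<^bsub>FR\<^esub> c" for d
  proof -
    obtain k where k: "k \<in> KER" "d = k \<oplus>\<^bsub>FR\<^esub> c"
      using d unfolding a_r_coset_def' by blast
    have "?L d = ?L k \<oplus>\<^bsub>P\<^esub> ?L c"
      unfolding k(2) by (rule linear_mapsD(2)[OF L K.a_Hcarr[OF k(1)] c])
    then show ?thesis
      using free_lift_tensor_kernel[OF k(1)] linear_mapsD(1)[OF L c] by simp
  qed
  moreover have "c \<in> KER +>\<^bsub>FR\<^esub> c"
    using c by (rule K.a_rcos_self)
  ultimately show ?thesis
    unfolding tensor_lift_def by (intro the_elem_image_unique) blast+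
qed

lemma tensor_lift_linear: "tensor_lift R P \<beta> \<in> linear_maps R TP P"
proof -
  note L = linear_mapsD[OF free_lift_linear[OF P bilinear_family]]
  note q = linear_mapsD(2,3)[OF tensor_quotient_map_linear, symmetric]
  show ?thesis
    by (rule linear_mapsI) (auto simp: tensor_carrier tensor_lift_coset L q)
qed

lemma tensor_lift_pure:
  assumes "x \<in> carrier M" "y \<in> carrier N"
  shows "tensor_lift R P \<beta> (pure_tensor R M N x y) = \<beta> x y"
  using assms free_lift_basis_vector[OF P bilinear_family, of "(x, y)"]
  by (simp add: pure_tensor_def tensor_lift_coset basis_vector_closed[OF M.R.is_cring])

end

text \<open>The argument of \<open>tensor_lift\<close> is a function on whole types; its behaviour
  outside the carriers has no influence. Later this trades the extensional identity map for the
  plain one in the antipode equations.\<close>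

lemma tensor_lift_cong:
  assumes P: "module R P" and \<beta>: "bilinear R M N P \<beta>"
    and eq: "\<And>x y. x \<in> carrier M \<Longrightarrow> y \<in> carrier N \<Longrightarrow> \<beta>' x y = \<beta> x y"
    and t: "t \<in> carrier TP"
  shows "tensor_lift R P \<beta>' t = tensor_lift R P \<beta> t"
proof -
  have \<beta>': "bilinear R M N P \<beta>'"
    using bilinearD[OF \<beta>] by (intro bilinearI linear_mapsI) (simp_all add: eq)
  interpret P: module R P by (rule P)
  show ?thesis
    by (rule tensor_linear_eqI[OF _ tensor_lift_linear[OF P \<beta>'] tensor_lift_linear[OF P \<beta>] _ t])
      (unfold_locales, simp add: tensor_lift_pure[OF P \<beta>'] tensor_lift_pure[OF P \<beta>] eq)
qed

end

lemma linear_maps_add: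
  assumes f: "f \<in> linear_maps R M N" and g: "g \<in> linear_maps R M N" and N: "module R N"
  shows "(\<lambda>x. f x \<oplus>\<^bsub>N\<^esub> g x) \<in> linear_maps R M N"
proof -
  interpret N: module R N by (rule N)
  show ?thesis
    using linear_mapsD[OF f] linear_mapsD[OF g]
    by (intro linear_mapsI) (simp_all add: N.M.add.m_ac N.smult_r_distr)
qed

lemma linear_maps_restrict:
  assumes f: "f \<in> linear_maps R M N" and M: "module R M"
  shows "(\<lambda>x\<in>carrier M. f x) \<in> linear_maps R M N"
proof -
  interpret M: module R M by (rule M)
  show ?thesis
    using linear_mapsD[OF f] by (intro linear_mapsI) simp_all
qed

text \<open>By induction on \<open>t\<close>: on a pure tensor the map is
  \<open>\<gamma> x y\<close>, and sums of linear maps are linear. Nested lifts, as in the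
  associator and in the product of a tensor algebra, are well behaved for this reason.\<close>

lemma (in module_pair) tensor_lift_param_linear:
  assumes Q: "module R Q" and P: "module R P"
    and bil: "\<And>z. z \<in> carrier P \<Longrightarrow> bilinear R M N Q (\<lambda>x y. \<gamma> x y z)"
    and lin: "\<And>x y. x \<in> carrier M \<Longrightarrow> y \<in> carrier N \<Longrightarrow> \<gamma> x y \<in> linear_maps R P Q"
    and t: "t \<in> carrier TP"
  shows "(\<lambda>z. tensor_lift R Q (\<lambda>x y. \<gamma> x y z) t) \<in> linear_maps R P Q"
  using t
proof (induction rule: tensor_induct)
  case (pure x y)
  interpret P: module R P by (rule P)
  show ?case
    using lin[OF pure] linear_mapsD[OF lin[OF pure]] pure
    by (intro linear_mapsI) (simp_all add: tensor_lift_pure[OF Q bil])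
next
  case (add s t)
  interpret P: module R P by (rule P)
  note eq = linear_mapsD(2)[OF tensor_lift_linear[OF Q bil] add.hyps]
  show ?case
    using linear_mapsD[OF linear_maps_add[OF add.IH Q]]
    by (intro linear_mapsI) (simp_all add: eq)
qed

lemma (in module_pair) tensor_lift_bilinear:
  assumes Q: "module R Q" and P: "module R P"
    and bil: "\<And>z. z \<in> carrier P \<Longrightarrow> bilinear R M N Q (\<lambda>x y. \<gamma> x y z)"
    and lin: "\<And>x y. x \<in> carrier M \<Longrightarrow> y \<in> carrier N \<Longrightarrow> \<gamma> x y \<in> linear_maps R P Q"
  shows "bilinear R TP P Q (\<lambda>t z. tensor_lift R Q (\<lambda>x y. \<gamma> x y z) t)"
  by (intro bilinearI tensor_lift_param_linear[OF Q P bil lin] tensor_lift_linear[OF Q bil])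

section \<open>Functoriality of the tensor product\<close>

context
  fixes R :: "('r, 'x) ring_scheme" and M :: "('r, 'm, 'y) module_scheme"
    and N :: "('r, 'n, 'z) module_scheme" and P :: "('r, 'p, 'u) module_scheme"
    and Q :: "('r, 'q, 'v) module_scheme" and f g
  assumes MN: "module_pair R M N" and PQ: "module_pair R P Q"
    and f: "f \<in> linear_maps R M P" and g: "g \<in> linear_maps R N Q"
begin

interpretation MN: module_pair R M N by (rule MN)
interpretation PQ: module_pair R P Q by (rule PQ)

lemma pure_tensor_map_bilinear:
  "bilinear R M N (tensor_product R P Q) (\<lambda>x y. pure_tensor R P Q (f x) (g y))"
  by (rule bilinear_compose[OF PQ.pure_tensor_bilinear f g, of "\<lambda>x. x"])
    (simp add: linear_maps_def)

lemma tensor_map_linear_map: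
  "tensor_map R P Q f g \<in> linear_maps R (tensor_product R M N) (tensor_product R P Q)"
  unfolding tensor_map_def
  by (rule MN.tensor_lift_linear[OF PQ.tensor_module pure_tensor_map_bilinear])

lemma tensor_map_pure:
  assumes "x \<in> carrier M" "y \<in> carrier N"
  shows "tensor_map R P Q f g (pure_tensor R M N x y) = pure_tensor R P Q (f x) (g y)"
  unfolding tensor_map_def
  by (rule MN.tensor_lift_pure[OF PQ.tensor_module pure_tensor_map_bilinear assms])

end

section \<open>The associator for threefold tensor products\<close>

context
  fixes R :: "('r, 'x) ring_scheme" and M :: "('r, 'm, 'y) module_scheme"
    and N :: "('r, 'n, 'z) module_scheme" and P :: "('r, 'p, 'u) module_scheme"
  assumes M: "module R M" and N: "module R N" and P: "module R P"
begin

interpretation MN: module_pair R M N by (intro module_pair.intro M N)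
interpretation NP: module_pair R N P by (intro module_pair.intro N P)
interpretation M_NP: module_pair R M "tensor_product R N P"
  by (intro module_pair.intro M NP.tensor_module)
interpretation MN_P: module_pair R "tensor_product R M N" P
  by (intro module_pair.intro MN.tensor_module P)

lemma pure_tensor_assoc_bilinear:
  assumes "z \<in> carrier P"
  shows "bilinear R M N (tensor_product R M (tensor_product R N P))
    (\<lambda>x y. pure_tensor R M (tensor_product R N P) x (pure_tensor R N P y z))"
  using assms
  by (intro bilinearI linear_mapsI) (simp_all add: M_NP.pure_tensor_simps NP.pure_tensor_simps)

lemma tensor_assoc_bilinear:
  "bilinear R (tensor_product R M N) P (tensor_product R M (tensor_product R N P))
    (\<lambda>t z. tensor_lift R (tensor_product R M (tensor_product R N P))
       (\<lambda>x y. pure_tensor R M (tensor_product R N P) x (pure_tensor R N P y z)) t)"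
  by (rule MN.tensor_lift_bilinear[OF M_NP.tensor_module P pure_tensor_assoc_bilinear])
    (auto intro!: linear_mapsI simp: M_NP.pure_tensor_simps NP.pure_tensor_simps)

lemma tensor_assoc_linear:
  "tensor_assoc R M N P \<in> linear_maps R (tensor_product R (tensor_product R M N) P)
     (tensor_product R M (tensor_product R N P))"
  unfolding tensor_assoc_def Let_def
  by (rule MN_P.tensor_lift_linear[OF M_NP.tensor_module tensor_assoc_bilinear])

lemma tensor_assoc_pure:
  assumes "t \<in> carrier (tensor_product R M N)" "z \<in> carrier P"
  shows "tensor_assoc R M N P (pure_tensor R (tensor_product R M N) P t z) =
    tensor_lift R (tensor_product R M (tensor_product R N P))
       (\<lambda>x y. pure_tensor R M (tensor_product R N P) x (pure_tensor R N P y z)) t"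
  unfolding tensor_assoc_def Let_def
  by (rule MN_P.tensor_lift_pure[OF M_NP.tensor_module tensor_assoc_bilinear assms])

end


section \<open>The convolution algebra\<close>

locale convolution = C: coalgebra R C + A: unital_algebra R A
  for R :: "('r, 'x) ring_scheme" and C :: "('r, 'c, 'y) coalgebra_scheme"
    and A :: "('r, 'a, 'z) module_scheme"
begin

sublocale CC: module_pair R C C
  by (intro module_pair.intro C.module_axioms)

abbreviation "H \<equiv> convolution_algebra R C A"

text \<open>The map \<open>f \<otimes> g\<close> followed by multiplication in \<open>A\<close>. At
  the comultiplication of \<open>x\<close> it gives the convolution product at \<open>x\<close>;
  leaving the tensor free makes it a linear map on the tensor square, to which
  \<open>tensor_linear_eqI\<close> applies.\<close>

definition pairing :: "('c \<Rightarrow> 'a) \<Rightarrow> ('c \<Rightarrow> 'a) \<Rightarrow> ('c \<times> 'c \<Rightarrow> 'r) set \<Rightarrow> 'a" where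
  "pairing f g = tensor_lift R A (\<lambda>y z. f y \<otimes>\<^bsub>A\<^esub> g z)"

lemma carrier_H: "carrier H = linear_maps R C A \<inter> extensional (carrier C)"
  by (simp add: convolution_algebra_def hom_module_def)

lemma H_linear: "f \<in> carrier H \<Longrightarrow> f \<in> linear_maps R C A"
  by (simp add: carrier_H)

lemma H_restrict: "f \<in> linear_maps R C A \<Longrightarrow> (\<lambda>x\<in>carrier C. f x) \<in> carrier H"
  by (simp add: carrier_H linear_maps_restrict[OF _ C.module_axioms])

lemma H_closed [simp]: "f \<in> carrier H \<Longrightarrow> x \<in> carrier C \<Longrightarrow> f x \<in> carrier A"
  using linear_mapsD(1)[OF H_linear] .

lemma H_eqI:
  assumes "f \<in> carrier H" "g \<in> carrier H" "\<And>x. x \<in> carrier C \<Longrightarrow> f x = g x"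
  shows "f = g"
  using assms by (intro extensionalityI[of _ "carrier C"]) (simp_all add: carrier_H)

lemma H_zero_apply: "x \<in> carrier C \<Longrightarrow> \<zero>\<^bsub>H\<^esub> x = \<zero>\<^bsub>A\<^esub>"
  and H_add_apply: "x \<in> carrier C \<Longrightarrow> (f \<oplus>\<^bsub>H\<^esub> g) x = f x \<oplus>\<^bsub>A\<^esub> g x"
  and H_one_apply: "x \<in> carrier C \<Longrightarrow> \<one>\<^bsub>H\<^esub> x = counit C x \<odot>\<^bsub>A\<^esub> \<one>\<^bsub>A\<^esub>"
  and H_mult_apply: "x \<in> carrier C \<Longrightarrow> (f \<otimes>\<^bsub>H\<^esub> g) x = pairing f g (comult C x)"
  by (simp_all add: convolution_algebra_def hom_module_def pairing_def)

lemma comult_closed [simp]: "x \<in> carrier C \<Longrightarrow> comult C x \<in> carrier CC.TP"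
  by (rule linear_mapsD(1)[OF C.comult_linear])

lemma counit_closed [simp]: "x \<in> carrier C \<Longrightarrow> counit C x \<in> carrier R"
  using linear_mapsD(1)[OF C.counit_linear] by (simp add: regular_module_def)

lemma pairing_bilinear:
  assumes "f \<in> linear_maps R C A" "g \<in> linear_maps R C A"
  shows "bilinear R C C A (\<lambda>y z. f y \<otimes>\<^bsub>A\<^esub> g z)"
  using linear_mapsD[OF assms(1)] linear_mapsD[OF assms(2)]
  by (intro bilinearI linear_mapsI)
    (simp_all add: A.A.l_distr A.A.r_distr A.smult_mult_left A.smult_mult_right)

lemma pairing_linear:
  "f \<in> linear_maps R C A \<Longrightarrow> g \<in> linear_maps R C A \<Longrightarrow> pairing f g \<in> linear_maps R CC.TP A"
  unfolding pairing_def by (rule CC.tensor_lift_linear[OF A.module_axioms pairing_bilinear])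

lemma pairing_pure:
  "f \<in> linear_maps R C A \<Longrightarrow> g \<in> linear_maps R C A \<Longrightarrow> y \<in> carrier C \<Longrightarrow> z \<in> carrier C \<Longrightarrow>
    pairing f g (pure_tensor R C C y z) = f y \<otimes>\<^bsub>A\<^esub> g z"
  unfolding pairing_def by (rule CC.tensor_lift_pure[OF A.module_axioms pairing_bilinear])

lemma pairing_cong:
  assumes "f \<in> linear_maps R C A" "g \<in> linear_maps R C A"
    and "\<And>x. x \<in> carrier C \<Longrightarrow> f' x = f x" "\<And>x. x \<in> carrier C \<Longrightarrow> g' x = g x"
    and "t \<in> carrier CC.TP"
  shows "pairing f' g' t = pairing f g t"
  unfolding pairing_def using assms
  by (intro CC.tensor_lift_cong[OF A.module_axioms pairing_bilinear]) simp_all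

lemma pairing_closed [simp]:
  assumes "f \<in> carrier H" "g \<in> carrier H" "t \<in> carrier CC.TP"
  shows "pairing f g t \<in> carrier A"
  using linear_mapsD(1)[OF pairing_linear[OF H_linear H_linear]] assms .

lemma H_mult_linear:
  assumes "f \<in> linear_maps R C A" "g \<in> linear_maps R C A"
  shows "f \<otimes>\<^bsub>H\<^esub> g \<in> carrier H"
proof -
  have eq: "f \<otimes>\<^bsub>H\<^esub> g = (\<lambda>x\<in>carrier C. pairing f g (comult C x))"
    by (simp add: convolution_algebra_def pairing_def)
  show ?thesis
    unfolding eq by (intro H_restrict linear_maps_compose[OF C.comult_linear pairing_linear[OF assms]])
qed

lemma H_mult_closed: "f \<in> carrier H \<Longrightarrow> g \<in> carrier H \<Longrightarrow> f \<otimes>\<^bsub>H\<^esub> g \<in> carrier H"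
  by (rule H_mult_linear[OF H_linear H_linear])

lemma const_linear:
  assumes "a \<in> carrier A"
  shows "(\<lambda>x. counit C x \<odot>\<^bsub>A\<^esub> a) \<in> linear_maps R C A"
  using assms linear_mapsD[OF C.counit_linear] unfolding regular_module_def
  by (intro linear_mapsI) (simp_all add: A.smult_l_distr A.smult_assoc1)

lemma H_one_closed: "\<one>\<^bsub>H\<^esub> \<in> carrier H"
proof -
  have eq: "\<one>\<^bsub>H\<^esub> = (\<lambda>x\<in>carrier C. counit C x \<odot>\<^bsub>A\<^esub> \<one>\<^bsub>A\<^esub>)"
    by (simp add: convolution_algebra_def)
  show ?thesis
    unfolding eq by (intro H_restrict const_linear A.A.one_closed)
qed

lemma H_add_closed:
  assumes "f \<in> carrier H" "g \<in> carrier H"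
  shows "f \<oplus>\<^bsub>H\<^esub> g \<in> carrier H"
proof -
  have eq: "f \<oplus>\<^bsub>H\<^esub> g = (\<lambda>x\<in>carrier C. f x \<oplus>\<^bsub>A\<^esub> g x)"
    by (simp add: convolution_algebra_def hom_module_def)
  show ?thesis
    unfolding eq by (intro H_restrict linear_maps_add H_linear assms A.module_axioms)
qed

lemma H_zero_closed: "\<zero>\<^bsub>H\<^esub> \<in> carrier H"
proof -
  have eq: "\<zero>\<^bsub>H\<^esub> = (\<lambda>x\<in>carrier C. \<zero>\<^bsub>A\<^esub>)"
    by (simp add: convolution_algebra_def hom_module_def)
  show ?thesis
    unfolding eq by (intro H_restrict linear_mapsI) simp_all
qed

lemma pairing_add_left:
  assumes f: "f \<in> carrier H" and g: "g \<in> carrier H" and h: "h \<in> carrier H"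
    and t: "t \<in> carrier CC.TP"
  shows "pairing (f \<oplus>\<^bsub>H\<^esub> g) h t = pairing f h t \<oplus>\<^bsub>A\<^esub> pairing g h t"
proof -
  note lin = H_linear[OF f] H_linear[OF g] H_linear[OF h] H_linear[OF H_add_closed[OF f g]]
  show ?thesis
    by (rule CC.tensor_linear_eqI[OF A.M.abelian_monoid_axioms pairing_linear[OF lin(4,3)]
          linear_maps_add[OF pairing_linear[OF lin(1,3)] pairing_linear[OF lin(2,3)] A.module_axioms] _ t])
      (simp add: pairing_pure lin H_add_apply A.A.l_distr A.A.r_distr f g h)
qed

lemma pairing_add_right:
  assumes f: "f \<in> carrier H" and g: "g \<in> carrier H" and h: "h \<in> carrier H"
    and t: "t \<in> carrier CC.TP"
  shows "pairing h (f \<oplus>\<^bsub>H\<^esub> g) t = pairing h f t \<oplus>\<^bsub>A\<^esub> pairing h g t"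
proof -
  note lin = H_linear[OF f] H_linear[OF g] H_linear[OF h] H_linear[OF H_add_closed[OF f g]]
  show ?thesis
    by (rule CC.tensor_linear_eqI[OF A.M.abelian_monoid_axioms pairing_linear[OF lin(3,4)]
          linear_maps_add[OF pairing_linear[OF lin(3,1)] pairing_linear[OF lin(3,2)] A.module_axioms] _ t])
      (simp add: pairing_pure lin H_add_apply A.A.l_distr A.A.r_distr f g h)
qed

lemma H_one_left:
  assumes f: "f \<in> carrier H" and x: "x \<in> carrier C"
  shows "(\<one>\<^bsub>H\<^esub> \<otimes>\<^bsub>H\<^esub> f) x = f x"
proof -
  note eps = linear_mapsD(2,3)[OF C.counit_linear, unfolded regular_module_def, simplified]
  have bil: "bilinear R C C C (\<lambda>y z. counit C y \<odot>\<^bsub>C\<^esub> z)"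
    by (intro bilinearI linear_mapsI)
      (simp_all add: eps C.smult_l_distr C.smult_r_distr C.smult_assoc1[symmetric] C.R.m_comm)
  \<comment> \<open>The claim is made for every tensor \<open>t\<close>, since a comultiplication is
    not pure in general; linearity in \<open>t\<close> then leaves only pure tensors, and the counit
    axiom enters at the end.\<close>
  have "pairing \<one>\<^bsub>H\<^esub> f t = f (tensor_lift R C (\<lambda>y z. counit C y \<odot>\<^bsub>C\<^esub> z) t)"
    if t: "t \<in> carrier CC.TP" for t
    using t
  proof (rule CC.tensor_linear_eqI[OF A.M.abelian_monoid_axioms, rotated -1])
    show "pairing \<one>\<^bsub>H\<^esub> f \<in> linear_maps R CC.TP A"
      by (intro pairing_linear H_linear f H_one_closed)
    show "(\<lambda>t. f (tensor_lift R C (\<lambda>y z. counit C y \<odot>\<^bsub>C\<^esub> z) t)) \<in> linear_maps R CC.TP A"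
      by (intro linear_maps_compose[OF CC.tensor_lift_linear[OF C.module_axioms bil]] H_linear f)
  qed (use f in \<open>simp add: pairing_pure CC.tensor_lift_pure[OF C.module_axioms bil] H_linear
      H_one_closed H_one_apply linear_mapsD(3)[OF H_linear] A.smult_mult_left\<close>)
  then show ?thesis
    using x by (simp add: H_mult_apply C.counit_left)
qed

lemma H_one_right:
  assumes f: "f \<in> carrier H" and x: "x \<in> carrier C"
  shows "(f \<otimes>\<^bsub>H\<^esub> \<one>\<^bsub>H\<^esub>) x = f x"
proof -
  note eps = linear_mapsD(2,3)[OF C.counit_linear, unfolded regular_module_def, simplified]
  have bil: "bilinear R C C C (\<lambda>y z. counit C z \<odot>\<^bsub>C\<^esub> y)"
    by (intro bilinearI linear_mapsI)
      (simp_all add: eps C.smult_l_distr C.smult_r_distr C.smult_assoc1[symmetric] C.R.m_comm)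
  have "pairing f \<one>\<^bsub>H\<^esub> t = f (tensor_lift R C (\<lambda>y z. counit C z \<odot>\<^bsub>C\<^esub> y) t)"
    if t: "t \<in> carrier CC.TP" for t
    using t
  proof (rule CC.tensor_linear_eqI[OF A.M.abelian_monoid_axioms, rotated -1])
    show "pairing f \<one>\<^bsub>H\<^esub> \<in> linear_maps R CC.TP A"
      by (intro pairing_linear H_linear f H_one_closed)
    show "(\<lambda>t. f (tensor_lift R C (\<lambda>y z. counit C z \<odot>\<^bsub>C\<^esub> y) t)) \<in> linear_maps R CC.TP A"
      by (intro linear_maps_compose[OF CC.tensor_lift_linear[OF C.module_axioms bil]] H_linear f)
  qed (use f in \<open>simp add: pairing_pure CC.tensor_lift_pure[OF C.module_axioms bil] H_linear
      H_one_closed H_one_apply linear_mapsD(3)[OF H_linear] A.smult_mult_right\<close>)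
  then show ?thesis
    using x by (simp add: H_mult_apply C.counit_right)
qed

text \<open>Let \<open>\<Phi>\<close> multiply out \<open>f\<close>, \<open>g\<close>,
  \<open>h\<close> on threefold tensors. Comultiplying the second factor and applying
  \<open>\<Phi>\<close> gives one bracketing; comultiplying the first factor, reassociating and
  applying \<open>\<Phi>\<close> gives the other. Coassociativity identifies the two.\<close>

lemma H_assoc:
  assumes f: "f \<in> carrier H" and g: "g \<in> carrier H" and h: "h \<in> carrier H"
  shows "(f \<otimes>\<^bsub>H\<^esub> g) \<otimes>\<^bsub>H\<^esub> h = f \<otimes>\<^bsub>H\<^esub> (g \<otimes>\<^bsub>H\<^esub> h)"
proof -
  interpret C_CC: module_pair R C CC.TP
    by (intro module_pair.intro C.module_axioms CC.tensor_module)
  interpret CC_C: module_pair R CC.TP C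
    by (intro module_pair.intro C.module_axioms CC.tensor_module)
  have id: "(\<lambda>y. y) \<in> linear_maps R C C"
    by (simp add: linear_maps_def)
  note lin = H_linear[OF f] H_linear[OF g] H_linear[OF h]
  note fg = H_mult_closed[OF f g] and gh = H_mult_closed[OF g h]
  note am = A.M.abelian_monoid_axioms
  define \<Phi> where "\<Phi> = tensor_lift R A (\<lambda>y s. f y \<otimes>\<^bsub>A\<^esub> pairing g h s)"
  have bil: "bilinear R C CC.TP A (\<lambda>y s. f y \<otimes>\<^bsub>A\<^esub> pairing g h s)"
    using linear_mapsD[OF lin(1)] linear_mapsD[OF pairing_linear[OF lin(2,3)]]
    by (intro bilinearI linear_mapsI)
      (simp_all add: A.A.l_distr A.A.r_distr A.smult_mult_left A.smult_mult_right)
  have \<Phi>: "\<Phi> \<in> linear_maps R C_CC.TP A"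
    unfolding \<Phi>_def by (rule C_CC.tensor_lift_linear[OF A.module_axioms bil])
  have \<Phi>_pure: "\<Phi> (pure_tensor R C CC.TP y s) = f y \<otimes>\<^bsub>A\<^esub> pairing g h s"
    if "y \<in> carrier C" "s \<in> carrier CC.TP" for y s
    unfolding \<Phi>_def by (rule C_CC.tensor_lift_pure[OF A.module_axioms bil that])
  note map_r = tensor_map_linear_map[OF CC.module_pair_axioms C_CC.module_pair_axioms id C.comult_linear]
    and map_r_pure = tensor_map_pure[OF CC.module_pair_axioms C_CC.module_pair_axioms id C.comult_linear]
    and map_l = tensor_map_linear_map[OF CC.module_pair_axioms CC_C.module_pair_axioms C.comult_linear id]
    and map_l_pure = tensor_map_pure[OF CC.module_pair_axioms CC_C.module_pair_axioms C.comult_linear id]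
  note assoc = tensor_assoc_linear[OF C.module_axioms C.module_axioms C.module_axioms]
    and assoc_pure = tensor_assoc_pure[OF C.module_axioms C.module_axioms C.module_axioms]
  have right: "\<Phi> (tensor_map R C CC.TP (\<lambda>y. y) (comult C) t) = pairing f (g \<otimes>\<^bsub>H\<^esub> h) t"
    if t: "t \<in> carrier CC.TP" for t
    by (rule CC.tensor_linear_eqI[OF am linear_maps_compose[OF map_r \<Phi>]
          pairing_linear[OF lin(1) H_linear[OF gh]] _ t])
      (simp add: map_r_pure \<Phi>_pure pairing_pure lin H_linear[OF gh] H_mult_apply)
  \<comment> \<open>Comultiplying the first factor turns it into a tensor \<open>s\<close> that need
    not be pure, so \<open>\<Phi>\<close> after the associator is computed for all \<open>s\<close>
    by linearity.\<close>
  have left_aux: "\<Phi> (tensor_lift R C_CC.TP (\<lambda>x y. pure_tensor R C CC.TP x (pure_tensor R C C y z)) s) =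
      pairing f g s \<otimes>\<^bsub>A\<^esub> h z" if s: "s \<in> carrier CC.TP" and z: "z \<in> carrier C" for s z
  proof -
    note b = pure_tensor_assoc_bilinear[OF C.module_axioms C.module_axioms C.module_axioms z]
    have r: "(\<lambda>s. pairing f g s \<otimes>\<^bsub>A\<^esub> h z) \<in> linear_maps R CC.TP A"
      using linear_mapsD[OF pairing_linear[OF lin(1,2)]] h z
      by (intro linear_mapsI) (simp_all add: A.A.l_distr A.smult_mult_left)
    show ?thesis
      using z f g h by (intro CC.tensor_linear_eqI[OF am linear_maps_compose[OF
            CC.tensor_lift_linear[OF C_CC.tensor_module b] \<Phi>] r _ s])
        (simp add: CC.tensor_lift_pure[OF C_CC.tensor_module b] \<Phi>_pure pairing_pure lin A.A.m_assoc)
  qed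
  have left: "\<Phi> (tensor_assoc R C C C (tensor_map R CC.TP C (comult C) (\<lambda>y. y) t)) =
      pairing (f \<otimes>\<^bsub>H\<^esub> g) h t" if t: "t \<in> carrier CC.TP" for t
    by (rule CC.tensor_linear_eqI[OF am linear_maps_compose[OF linear_maps_compose[OF map_l assoc] \<Phi>]
          pairing_linear[OF H_linear[OF fg] lin(3)] _ t])
      (simp add: map_l_pure assoc_pure left_aux pairing_pure lin H_linear[OF fg] H_mult_apply)
  show ?thesis
  proof (rule H_eqI)
    fix x assume x: "x \<in> carrier C"
    show "(f \<otimes>\<^bsub>H\<^esub> g \<otimes>\<^bsub>H\<^esub> h) x = (f \<otimes>\<^bsub>H\<^esub> (g \<otimes>\<^bsub>H\<^esub> h)) x"
      using x left[of "comult C x"] right[of "comult C x"] C.coassoc[OF x] by (simp add: H_mult_apply)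
  qed (intro H_mult_closed f g h)+
qed

lemma H_ring: "ring H"
proof (rule ringI)
  show "abelian_group H"
  proof (rule abelian_groupI)
    fix f assume f: "f \<in> carrier H"
    have neg: "(\<lambda>x\<in>carrier C. \<ominus>\<^bsub>A\<^esub> f x) \<in> carrier H"
      using f linear_mapsD[OF H_linear[OF f]]
      by (intro H_restrict linear_mapsI) (simp_all add: A.M.minus_add A.smult_r_minus)
    show "\<exists>g\<in>carrier H. g \<oplus>\<^bsub>H\<^esub> f = \<zero>\<^bsub>H\<^esub>"
      using f neg by (intro bexI[OF _ neg] H_eqI[OF H_add_closed H_zero_closed])
        (simp_all add: H_add_apply H_zero_apply A.M.l_neg)
  qed (auto intro!: H_eqI H_add_closed H_zero_closed simp: H_add_apply H_zero_apply A.M.add.m_ac)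
  show "monoid H"
    by (rule monoidI) (auto intro!: H_mult_closed H_one_closed H_assoc H_one_left H_one_right
        intro: H_eqI)
qed (auto intro!: H_eqI H_mult_closed H_add_closed
    simp: H_mult_apply H_add_apply pairing_add_left pairing_add_right)

end

section \<open>Local invertibility\<close>

lemma (in abelian_group) minus_eq_zero_iff:
  assumes "x \<in> carrier G" "y \<in> carrier G"
  shows "x \<ominus> y = \<zero> \<longleftrightarrow> x = y"
  using assms add.inv_solve_right[of "\<zero>" x y] by (auto simp: a_minus_def)

context convolution
begin

sublocale H: ring H
  by (rule H_ring)

lemma H_minus_apply:
  assumes f: "f \<in> carrier H" and g: "g \<in> carrier H" and x: "x \<in> carrier C"
  shows "(f \<ominus>\<^bsub>H\<^esub> g) x = f x \<ominus>\<^bsub>A\<^esub> g x"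
proof -
  have "(g \<oplus>\<^bsub>H\<^esub> \<ominus>\<^bsub>H\<^esub> g) x = \<zero>\<^bsub>H\<^esub> x"
    using g by (simp only: H.r_neg)
  then have "\<ominus>\<^bsub>A\<^esub> g x = (\<ominus>\<^bsub>H\<^esub> g) x"
    using g x by (intro A.M.minus_equality) (simp_all add: H_add_apply H_zero_apply A.M.a_comm)
  then show ?thesis
    using x by (simp add: a_minus_def H_add_apply)
qed

section \<open>The ideals attached to points of the coalgebra\<close>

text \<open>This is the ideal \<open>I\<^sub>x\<close>. Merely vanishing at \<open>x\<close> need
  not define an ideal, so all products with \<open>u\<close> on the left and \<open>v\<close> on the
  right are required to vanish there as well.\<close>

definition annihilator :: "'c \<Rightarrow> ('c \<Rightarrow> 'a) set" where
  "annihilator x = {e \<in> carrier H. \<forall>u\<in>carrier H. \<forall>v\<in>carrier H. (u \<otimes>\<^bsub>H\<^esub> e \<otimes>\<^bsub>H\<^esub> v) x = \<zero>\<^bsub>A\<^esub>}"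

lemma annihilator_closed: "e \<in> annihilator x \<Longrightarrow> e \<in> carrier H"
  by (simp add: annihilator_def)

lemma annihilatorD:
  assumes "e \<in> annihilator x"
  shows "e x = \<zero>\<^bsub>A\<^esub>"
proof -
  have "(\<one>\<^bsub>H\<^esub> \<otimes>\<^bsub>H\<^esub> e \<otimes>\<^bsub>H\<^esub> \<one>\<^bsub>H\<^esub>) x = \<zero>\<^bsub>A\<^esub>"
    using assms H.one_closed unfolding annihilator_def by blast
  then show ?thesis
    using annihilator_closed[OF assms] by simp
qed

lemma annihilator_mult_left:
  assumes e: "e \<in> annihilator x" and w: "w \<in> carrier H"
  shows "w \<otimes>\<^bsub>H\<^esub> e \<in> annihilator x"
  unfolding annihilator_def
proof (intro CollectI conjI ballI)
  note e' = annihilator_closed[OF e]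
  fix u v assume uv: "u \<in> carrier H" "v \<in> carrier H"
  have "((u \<otimes>\<^bsub>H\<^esub> w) \<otimes>\<^bsub>H\<^esub> e \<otimes>\<^bsub>H\<^esub> v) x = \<zero>\<^bsub>A\<^esub>"
    using e uv w unfolding annihilator_def by blast
  then show "(u \<otimes>\<^bsub>H\<^esub> (w \<otimes>\<^bsub>H\<^esub> e) \<otimes>\<^bsub>H\<^esub> v) x = \<zero>\<^bsub>A\<^esub>"
    using e' uv w by (simp add: H.m_assoc)
qed (use annihilator_closed[OF e] w in simp)

lemma annihilator_mult_right:
  assumes e: "e \<in> annihilator x" and w: "w \<in> carrier H"
  shows "e \<otimes>\<^bsub>H\<^esub> w \<in> annihilator x"
  unfolding annihilator_def
proof (intro CollectI conjI ballI)
  note e' = annihilator_closed[OF e]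
  fix u v assume uv: "u \<in> carrier H" "v \<in> carrier H"
  have "(u \<otimes>\<^bsub>H\<^esub> e \<otimes>\<^bsub>H\<^esub> (w \<otimes>\<^bsub>H\<^esub> v)) x = \<zero>\<^bsub>A\<^esub>"
    using e uv w unfolding annihilator_def by blast
  then show "(u \<otimes>\<^bsub>H\<^esub> (e \<otimes>\<^bsub>H\<^esub> w) \<otimes>\<^bsub>H\<^esub> v) x = \<zero>\<^bsub>A\<^esub>"
    using e' uv w by (simp add: H.m_assoc)
qed (use annihilator_closed[OF e] w in simp)

lemma annihilator_add:
  assumes x: "x \<in> carrier C" and y: "y \<in> carrier C"
    and e: "e \<in> annihilator x" "e \<in> annihilator y"
  shows "e \<in> annihilator (x \<oplus>\<^bsub>C\<^esub> y)"
  unfolding annihilator_def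
proof (intro CollectI conjI ballI)
  fix u v assume uv: "u \<in> carrier H" "v \<in> carrier H"
  then have w: "u \<otimes>\<^bsub>H\<^esub> e \<otimes>\<^bsub>H\<^esub> v \<in> carrier H"
    using annihilator_closed[OF e(1)] by simp
  have "(u \<otimes>\<^bsub>H\<^esub> e \<otimes>\<^bsub>H\<^esub> v) x = \<zero>\<^bsub>A\<^esub>" "(u \<otimes>\<^bsub>H\<^esub> e \<otimes>\<^bsub>H\<^esub> v) y = \<zero>\<^bsub>A\<^esub>"
    using e uv unfolding annihilator_def by blast+
  then show "(u \<otimes>\<^bsub>H\<^esub> e \<otimes>\<^bsub>H\<^esub> v) (x \<oplus>\<^bsub>C\<^esub> y) = \<zero>\<^bsub>A\<^esub>"
    using linear_mapsD(2)[OF H_linear[OF w] x y] by simp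
qed (rule annihilator_closed[OF e(1)])

lemma annihilator_smult:
  assumes a: "a \<in> carrier R" and x: "x \<in> carrier C" and e: "e \<in> annihilator x"
  shows "e \<in> annihilator (a \<odot>\<^bsub>C\<^esub> x)"
  unfolding annihilator_def
proof (intro CollectI conjI ballI)
  fix u v assume uv: "u \<in> carrier H" "v \<in> carrier H"
  then have w: "u \<otimes>\<^bsub>H\<^esub> e \<otimes>\<^bsub>H\<^esub> v \<in> carrier H"
    using annihilator_closed[OF e] by simp
  have "(u \<otimes>\<^bsub>H\<^esub> e \<otimes>\<^bsub>H\<^esub> v) x = \<zero>\<^bsub>A\<^esub>"
    using e uv unfolding annihilator_def by blast
  then show "(u \<otimes>\<^bsub>H\<^esub> e \<otimes>\<^bsub>H\<^esub> v) (a \<odot>\<^bsub>C\<^esub> x) = \<zero>\<^bsub>A\<^esub>"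
    using linear_mapsD(3)[OF H_linear[OF w] a x] a by simp
qed (rule annihilator_closed[OF e])

lemma annihilator_zero:
  assumes "e \<in> carrier H"
  shows "e \<in> annihilator \<zero>\<^bsub>C\<^esub>"
  unfolding annihilator_def using assms
  by (auto intro!: linear_maps_zero[OF H_linear C.M.abelian_group_axioms A.M.abelian_group_axioms])

lemma H_mult_grouplike:
  assumes "g \<in> carrier C" "comult C g = pure_tensor R C C g g" "u \<in> carrier H" "v \<in> carrier H"
  shows "(u \<otimes>\<^bsub>H\<^esub> v) g = u g \<otimes>\<^bsub>A\<^esub> v g"
  using assms by (simp add: H_mult_apply pairing_pure H_linear)

text \<open>Evaluation at such a \<open>g\<close> is multiplicative, so vanishing at
  \<open>g\<close> alone already passes to all products.\<close>

lemma annihilator_grouplike: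
  assumes g: "g \<in> carrier C" "comult C g = pure_tensor R C C g g"
    and e: "e \<in> carrier H" "e g = \<zero>\<^bsub>A\<^esub>"
  shows "e \<in> annihilator g"
  unfolding annihilator_def using g e by (simp add: H_mult_grouplike)

definition inverts_at :: "('c \<Rightarrow> 'a) \<Rightarrow> ('c \<Rightarrow> 'a) \<Rightarrow> 'c \<Rightarrow> bool" where
  "inverts_at f p x \<longleftrightarrow> \<one>\<^bsub>H\<^esub> \<ominus>\<^bsub>H\<^esub> f \<otimes>\<^bsub>H\<^esub> p \<in> annihilator x \<and> \<one>\<^bsub>H\<^esub> \<ominus>\<^bsub>H\<^esub> p \<otimes>\<^bsub>H\<^esub> f \<in> annihilator x"

definition invertible_at :: "('c \<Rightarrow> 'a) \<Rightarrow> 'c \<Rightarrow> bool" where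
  "invertible_at f x \<longleftrightarrow> x \<in> carrier C \<and> (\<exists>p\<in>carrier H. inverts_at f p x)"

definition combine :: "('c \<Rightarrow> 'a) \<Rightarrow> ('c \<Rightarrow> 'a) \<Rightarrow> ('c \<Rightarrow> 'a) \<Rightarrow> 'c \<Rightarrow> 'a" where
  "combine f p q = p \<oplus>\<^bsub>H\<^esub> q \<ominus>\<^bsub>H\<^esub> p \<otimes>\<^bsub>H\<^esub> f \<otimes>\<^bsub>H\<^esub> q"

section \<open>Inverses of a fixed element modulo the ideals of points\<close>

context
  fixes f assumes f: "f \<in> carrier H"
begin

lemma combine_closed: "p \<in> carrier H \<Longrightarrow> q \<in> carrier H \<Longrightarrow> combine f p q \<in> carrier H"
  using f by (simp add: combine_def)

lemma combine_defects:
  assumes p: "p \<in> carrier H" and q: "q \<in> carrier H"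
  shows "\<one>\<^bsub>H\<^esub> \<ominus>\<^bsub>H\<^esub> f \<otimes>\<^bsub>H\<^esub> combine f p q =
      (\<one>\<^bsub>H\<^esub> \<ominus>\<^bsub>H\<^esub> f \<otimes>\<^bsub>H\<^esub> p) \<otimes>\<^bsub>H\<^esub> (\<one>\<^bsub>H\<^esub> \<ominus>\<^bsub>H\<^esub> f \<otimes>\<^bsub>H\<^esub> q)"
    and "\<one>\<^bsub>H\<^esub> \<ominus>\<^bsub>H\<^esub> combine f p q \<otimes>\<^bsub>H\<^esub> f =
      (\<one>\<^bsub>H\<^esub> \<ominus>\<^bsub>H\<^esub> p \<otimes>\<^bsub>H\<^esub> f) \<otimes>\<^bsub>H\<^esub> (\<one>\<^bsub>H\<^esub> \<ominus>\<^bsub>H\<^esub> q \<otimes>\<^bsub>H\<^esub> f)"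
  unfolding combine_def using f p q
  by (simp_all add: a_minus_def H.l_distr H.r_distr H.minus_add H.r_minus H.l_minus H.m_assoc
      H.add.m_ac)

lemma defect_closed [simp]:
  "p \<in> carrier H \<Longrightarrow> \<one>\<^bsub>H\<^esub> \<ominus>\<^bsub>H\<^esub> f \<otimes>\<^bsub>H\<^esub> p \<in> carrier H"
  "p \<in> carrier H \<Longrightarrow> \<one>\<^bsub>H\<^esub> \<ominus>\<^bsub>H\<^esub> p \<otimes>\<^bsub>H\<^esub> f \<in> carrier H"
  using f by simp_all

text \<open>By \<open>combine_defects\<close> each new defect is a product of old ones, and a
  two-sided ideal contains the product as soon as it contains either factor.\<close>

lemma inverts_at_combine:
  assumes "p \<in> carrier H" "q \<in> carrier H" "inverts_at f p x \<or> inverts_at f q x"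
  shows "inverts_at f (combine f p q) x"
  using assms by (auto simp: inverts_at_def combine_defects
      intro: annihilator_mult_left annihilator_mult_right)

lemma inverts_at_finite:
  assumes "finite Y" "\<And>y. y \<in> Y \<Longrightarrow> invertible_at f y"
  shows "\<exists>p\<in>carrier H. \<forall>y\<in>Y. inverts_at f p y"
  using assms
proof (induction rule: finite_induct)
  case (insert y Y)
  obtain p where p: "p \<in> carrier H" "\<forall>y\<in>Y. inverts_at f p y"
    using insert by auto
  obtain q where q: "q \<in> carrier H" "inverts_at f q y"
    using insert.prems by (auto simp: invertible_at_def)
  show ?case
    using p q combine_closed[OF p(1) q(1)] inverts_at_combine[OF p(1) q(1)] by blast
qed auto

text \<open>The usual uniqueness argument for inverses, carried out modulo the ideal of
  \<open>x\<close>: both \<open>p\<close> and \<open>q\<close> are congruent to the product of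
  \<open>p\<close>, \<open>f\<close> and \<open>q\<close>. The elements \<open>?u\<close> and
  \<open>?v\<close> are the two differences.\<close>

lemma inverts_at_unique:
  assumes p: "p \<in> carrier H" "inverts_at f p x" and q: "q \<in> carrier H" "inverts_at f q x"
    and x: "x \<in> carrier C"
  shows "p x = q x"
proof -
  let ?u = "p \<otimes>\<^bsub>H\<^esub> (\<one>\<^bsub>H\<^esub> \<ominus>\<^bsub>H\<^esub> f \<otimes>\<^bsub>H\<^esub> q)" and ?v = "(\<one>\<^bsub>H\<^esub> \<ominus>\<^bsub>H\<^esub> p \<otimes>\<^bsub>H\<^esub> f) \<otimes>\<^bsub>H\<^esub> q"
  have u: "?u \<in> annihilator x" and v: "?v \<in> annihilator x"
    using p q by (auto simp: inverts_at_def intro: annihilator_mult_left annihilator_mult_right)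
  have u': "?u = p \<ominus>\<^bsub>H\<^esub> p \<otimes>\<^bsub>H\<^esub> f \<otimes>\<^bsub>H\<^esub> q" and v': "?v = q \<ominus>\<^bsub>H\<^esub> p \<otimes>\<^bsub>H\<^esub> f \<otimes>\<^bsub>H\<^esub> q"
    using p q f by (simp_all add: a_minus_def H.l_distr H.r_distr H.l_minus H.r_minus H.m_assoc)
  let ?w = "(p \<otimes>\<^bsub>H\<^esub> f \<otimes>\<^bsub>H\<^esub> q) x"
  have w: "?w \<in> carrier A" using p q f x by simp
  have "p x \<ominus>\<^bsub>A\<^esub> ?w = \<zero>\<^bsub>A\<^esub>" "q x \<ominus>\<^bsub>A\<^esub> ?w = \<zero>\<^bsub>A\<^esub>"
    using annihilatorD[OF u] annihilatorD[OF v] p q f x unfolding u' v'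
    by (simp_all add: H_minus_apply)
  then show ?thesis
    using w p q x by (simp add: A.M.minus_eq_zero_iff)
qed

lemma invertible_at_add:
  assumes "invertible_at f x" "invertible_at f y"
  shows "invertible_at f (x \<oplus>\<^bsub>C\<^esub> y)"
proof -
  \<comment> \<open>One \<open>p\<close> must serve both points, because
    \<open>annihilator_add\<close> compares the same element in the two ideals.\<close>
  obtain p where "p \<in> carrier H" "inverts_at f p x" "inverts_at f p y"
    using inverts_at_finite[of "{x, y}"] assms by auto
  then show ?thesis
    using assms by (auto simp: invertible_at_def inverts_at_def intro!: annihilator_add)
qed

lemma invertible_at_smult:
  assumes "a \<in> carrier R" "invertible_at f x"
  shows "invertible_at f (a \<odot>\<^bsub>C\<^esub> x)"
  using assms by (auto simp: invertible_at_def inverts_at_def intro!: annihilator_smult)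

lemma invertible_at_grouplike:
  assumes g: "g \<in> gpl R C" and u: "f g \<in> Units A"
  shows "invertible_at f g"
proof -
  have g': "g \<in> carrier C" "comult C g = pure_tensor R C C g g" "counit C g = \<one>\<^bsub>R\<^esub>"
    using g by (auto simp: gpl_def)
  \<comment> \<open>A multiple of the counit is linear on all of \<open>C\<close>, and since
    \<open>counit C g\<close> is one, its value at \<open>g\<close> is the inverse of
    \<open>f g\<close>. By \<open>annihilator_grouplike\<close> only this value matters.\<close>
  define p where "p = (\<lambda>x\<in>carrier C. counit C x \<odot>\<^bsub>A\<^esub> inv\<^bsub>A\<^esub> f g)"
  have p: "p \<in> carrier H"
    unfolding p_def using u by (intro H_restrict const_linear) simp
  have pg: "p g = inv\<^bsub>A\<^esub> f g"
    using g' u by (simp add: p_def)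
  have "inverts_at f p g"
    unfolding inverts_at_def using g' f p u
    by (auto intro!: annihilator_grouplike
        simp: H_minus_apply H_mult_grouplike H_one_apply pg A.M.minus_eq_zero_iff)
  then show ?thesis
    using p g' by (auto simp: invertible_at_def)
qed

section \<open>Climbing the Quillen filtration\<close>

text \<open>Records the elements occurring in a tensor without choosing a presentation of it: a
  finite set \<open>Y\<close> of points where \<open>f\<close> is invertible, such that two maps
  vanishing on \<open>Y\<close> pair to zero on \<open>t\<close>.\<close>

definition vanishing_base :: "('c \<times> 'c \<Rightarrow> 'r) set \<Rightarrow> 'c set \<Rightarrow> bool" where
  "vanishing_base t Y \<longleftrightarrow> finite Y \<and> (\<forall>y\<in>Y. invertible_at f y) \<and>
     (\<forall>e\<in>carrier H. \<forall>e'\<in>carrier H. (\<forall>y\<in>Y. e y = \<zero>\<^bsub>A\<^esub> \<and> e' y = \<zero>\<^bsub>A\<^esub>) \<longrightarrow> pairing e e' t = \<zero>\<^bsub>A\<^esub>)"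

lemma vanishing_base_add:
  assumes "s \<in> carrier CC.TP" "t \<in> carrier CC.TP" "vanishing_base s Y" "vanishing_base t Z"
  shows "vanishing_base (s \<oplus>\<^bsub>CC.TP\<^esub> t) (Y \<union> Z)"
  using assms unfolding vanishing_base_def
  by (auto simp: linear_mapsD(2)[OF pairing_linear[OF H_linear H_linear]])

lemma vanishing_base_finite_sums:
  assumes S: "S \<subseteq> carrier CC.TP" and t: "t \<in> finite_sums CC.TP S"
    and base: "\<And>s. s \<in> S \<Longrightarrow> \<exists>Y. vanishing_base s Y"
  shows "\<exists>Y. vanishing_base t Y"
  using S t
proof (induction rule: CC.T.M.finite_sums_induct)
  case zero
  have "vanishing_base \<zero>\<^bsub>CC.TP\<^esub> {}"
    unfolding vanishing_base_def
    using linear_maps_zero[OF pairing_linear[OF H_linear H_linear] CC.T.M.abelian_group_axioms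
        A.M.abelian_group_axioms] by simp
  then show ?case ..
next
  case (add t s)
  then show ?case
    using S base vanishing_base_add by blast
qed

text \<open>The set \<open>{x, y}\<close> serves for the pure tensor of \<open>x\<close> and
  \<open>y\<close>, where a pairing is a product of values at these points; finite sums are served
  by unions.\<close>

lemma vanishing_base_box_tensor:
  assumes "\<And>x. x \<in> M \<Longrightarrow> invertible_at f x" "\<And>x. x \<in> N \<Longrightarrow> invertible_at f x"
    and "t \<in> box_tensor R C M N"
  shows "t \<in> carrier CC.TP" "\<exists>Y. vanishing_base t Y"
proof -
  have inC: "x \<in> carrier C" if "x \<in> M \<or> x \<in> N" for x
    using that assms by (auto simp: invertible_at_def)
  have S: "{pure_tensor R C C x y |x y. x \<in> M \<and> y \<in> N} \<subseteq> carrier CC.TP"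
    using inC by auto
  have t: "t \<in> finite_sums CC.TP {pure_tensor R C C x y |x y. x \<in> M \<and> y \<in> N}"
    using assms by (simp add: box_tensor_def)
  show "t \<in> carrier CC.TP"
    by (rule CC.T.M.finite_sums_closed[OF S t])
  show "\<exists>Y. vanishing_base t Y"
  proof (rule vanishing_base_finite_sums[OF S t])
    fix s assume "s \<in> {pure_tensor R C C x y |x y. x \<in> M \<and> y \<in> N}"
    then obtain x y where xy: "x \<in> M" "y \<in> N" "s = pure_tensor R C C x y" by auto
    then have "vanishing_base s {x, y}"
      using assms inC unfolding vanishing_base_def by (simp add: pairing_pure H_linear)
    then show "\<exists>Y. vanishing_base s Y" ..
  qed
qed

lemma invertible_at_quillen_step:
  assumes x: "x \<in> carrier C" and g: "invertible_at f g" and h: "invertible_at f h"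
    and base: "vanishing_base (reduced_comult R C g h x) Y"
  shows "invertible_at f x"
proof -
  have gh: "g \<in> carrier C" "h \<in> carrier C"
    using g h by (auto simp: invertible_at_def)
  have "\<exists>p\<in>carrier H. \<forall>y\<in>insert g (insert h Y). inverts_at f p y"
    using g h base by (intro inverts_at_finite) (auto simp: vanishing_base_def)
  then obtain p where p: "p \<in> carrier H" "\<And>y. y \<in> insert g (insert h Y) \<Longrightarrow> inverts_at f p y"
    by blast
  \<comment> \<open>The inclusion of \<open>J\<^sup>2\<close> in \<open>I\<^sub>x\<close>, for
    squares of single elements: splitting the outer product between the two copies of
    \<open>e\<close> makes both halves vanish at \<open>g\<close>, at \<open>h\<close> and on
    \<open>Y\<close>.\<close>
  have prod: "e \<otimes>\<^bsub>H\<^esub> e \<in> annihilator x"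
    if e: "\<And>y. y \<in> insert g (insert h Y) \<Longrightarrow> e \<in> annihilator y" for e
    unfolding annihilator_def
  proof (intro CollectI conjI ballI)
    note e' = annihilator_closed[OF e[OF insertI1]]
    show "e \<otimes>\<^bsub>H\<^esub> e \<in> carrier H" using e' by simp
    fix u v assume u: "u \<in> carrier H" and v: "v \<in> carrier H"
    let ?a = "u \<otimes>\<^bsub>H\<^esub> e" and ?b = "e \<otimes>\<^bsub>H\<^esub> v"
    have a: "?a \<in> carrier H" and b: "?b \<in> carrier H"
      using u v e' by simp_all
    have z: "?a y = \<zero>\<^bsub>A\<^esub>" "?b y = \<zero>\<^bsub>A\<^esub>" if "y \<in> insert g (insert h Y)" for y
      using annihilatorD[OF annihilator_mult_left[OF e[OF that] u]]
        annihilatorD[OF annihilator_mult_right[OF e[OF that] v]] by simp_all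
    note lin = pairing_linear[OF H_linear[OF a] H_linear[OF b]]
    have minus: "pairing ?a ?b (s \<ominus>\<^bsub>CC.TP\<^esub> t) = pairing ?a ?b s \<ominus>\<^bsub>A\<^esub> pairing ?a ?b t"
      if "s \<in> carrier CC.TP" "t \<in> carrier CC.TP" for s t
      by (rule linear_maps_minus[OF lin CC.T.M.abelian_group_axioms A.M.abelian_group_axioms that])
    have "pairing ?a ?b (reduced_comult R C g h x) = \<zero>\<^bsub>A\<^esub>"
      using base z a b unfolding vanishing_base_def by blast
    \<comment> \<open>The comultiplication is the reduced one plus the tensors of \<open>g\<close>
      with \<open>x\<close> and of \<open>x\<close> with \<open>h\<close>. These pair to zero
      because \<open>?a\<close> vanishes at \<open>g\<close> and \<open>?b\<close> at
      \<open>h\<close>, whatever the values at \<open>x\<close>.\<close>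
    then have "pairing ?a ?b (comult C x) = \<zero>\<^bsub>A\<^esub>"
      using x gh a b z unfolding reduced_comult_def
      by (simp add: minus pairing_pure H_linear) (simp add: a_minus_def)
    then have "(?a \<otimes>\<^bsub>H\<^esub> ?b) x = \<zero>\<^bsub>A\<^esub>"
      using x by (simp add: H_mult_apply)
    then show "(u \<otimes>\<^bsub>H\<^esub> (e \<otimes>\<^bsub>H\<^esub> e) \<otimes>\<^bsub>H\<^esub> v) x = \<zero>\<^bsub>A\<^esub>"
      using u v e' by (simp add: H.m_assoc)
  qed
  \<comment> \<open>Combining \<open>p\<close> with itself squares both defects, so
    \<open>prod\<close> applies to each.\<close>
  have "inverts_at f (combine f p p) x"
    unfolding inverts_at_def combine_defects[OF p(1) p(1)]
    using p(2) by (intro conjI prod) (auto simp: inverts_at_def)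
  then show ?thesis
    using x combine_closed[OF p(1) p(1)] by (auto simp: invertible_at_def)
qed

lemma invertible_at_quillen:
  assumes gpl: "\<And>g. g \<in> sgpl R C \<Longrightarrow> invertible_at f g"
    and "g \<in> sgpl R C" "h \<in> sgpl R C" "x \<in> quillen R C n g h"
  shows "invertible_at f x"
  using assms(2-4)
\<comment> \<open>The endpoints must vary, since level \<open>Suc n\<close> for the pair
  \<open>g\<close>, \<open>h\<close> refers to level \<open>n\<close> for the pairs
  \<open>g\<close>, \<open>t\<close> and \<open>t\<close>, \<open>h\<close>. At level zero
  \<open>x\<close> is a multiple of \<open>g\<close>.\<close>
proof (induction n arbitrary: g h x)
  case 0
  then show ?case
    using gpl invertible_at_smult by (auto simp: cyclic_submodule_def)
next
  case (Suc n)
  let ?S = "\<Union>t\<in>sgpl R C. box_tensor R C (quillen R C n g t) (quillen R C n t h)"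
  have box: "s \<in> carrier CC.TP \<and> (\<exists>Y. vanishing_base s Y)" if "s \<in> ?S" for s
  proof -
    obtain t where t: "t \<in> sgpl R C" "s \<in> box_tensor R C (quillen R C n g t) (quillen R C n t h)"
      using \<open>s \<in> ?S\<close> by auto
    show ?thesis
      using vanishing_base_box_tensor[OF Suc.IH[OF Suc.prems(1) t(1)] Suc.IH[OF t(1) Suc.prems(2)] t(2)]
      by simp
  qed
  have "x \<in> carrier C" "reduced_comult R C g h x \<in> finite_sums CC.TP ?S"
    using Suc.prems(3) by auto
  moreover have "\<exists>Y. vanishing_base (reduced_comult R C g h x) Y"
    using box by (intro vanishing_base_finite_sums[OF _ calculation(2)]) auto
  ultimately show ?case
    using invertible_at_quillen_step gpl Suc.prems by blast
qed

section \<open>Gluing the local inverses\<close>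

text \<open>A tensor is a finite sum of pure ones, so pairing with \<open>f\<close> sees the other
  map at finitely many points only. Thus a map that agrees with elements of \<open>H\<close> merely
  on finite sets can still be multiplied by \<open>f\<close> through them.\<close>

lemma pairing_finite_dependence:
  assumes "t \<in> carrier CC.TP"
  shows "\<exists>Y\<subseteq>carrier C. finite Y \<and> (\<forall>p\<in>carrier H. \<forall>q\<in>carrier H. (\<forall>y\<in>Y. p y = q y) \<longrightarrow>
    pairing f p t = pairing f q t \<and> pairing p f t = pairing q f t)"
  using assms
proof (induction rule: CC.tensor_induct)
  case (pure x y)
  then show ?case
    using f by (intro exI[of _ "{x, y}"]) (simp add: pairing_pure H_linear)
next
  case (add s t)
  note eq = linear_mapsD(2)[OF pairing_linear[OF H_linear H_linear] add.hyps]
  obtain Y where Y: "Y \<subseteq> carrier C" "finite Y"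
    "\<And>p q. p \<in> carrier H \<Longrightarrow> q \<in> carrier H \<Longrightarrow> (\<forall>y\<in>Y. p y = q y) \<Longrightarrow>
      pairing f p s = pairing f q s \<and> pairing p f s = pairing q f s"
    using add.IH(1) by blast
  obtain Z where Z: "Z \<subseteq> carrier C" "finite Z"
    "\<And>p q. p \<in> carrier H \<Longrightarrow> q \<in> carrier H \<Longrightarrow> (\<forall>y\<in>Z. p y = q y) \<Longrightarrow>
      pairing f p t = pairing f q t \<and> pairing p f t = pairing q f t"
    using add.IH(2) by blast
  show ?case
  proof (intro exI[of _ "Y \<union> Z"] conjI ballI impI)
    fix p q assume pq: "p \<in> carrier H" "q \<in> carrier H" "\<forall>y\<in>Y \<union> Z. p y = q y"
    have "pairing f p s = pairing f q s \<and> pairing p f s = pairing q f s"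
      "pairing f p t = pairing f q t \<and> pairing p f t = pairing q f t"
      using pq Y(3) Z(3) by blast+
    then show "pairing f p (s \<oplus>\<^bsub>CC.TP\<^esub> t) = pairing f q (s \<oplus>\<^bsub>CC.TP\<^esub> t)"
      "pairing p f (s \<oplus>\<^bsub>CC.TP\<^esub> t) = pairing q f (s \<oplus>\<^bsub>CC.TP\<^esub> t)"
      using pq(1,2) f by (simp_all only: eq)
  qed (use Y Z in auto)
qed

text \<open>
  The local inverses agree where they are defined, because an inverse modulo the ideal
  \<open>annihilator x\<close> is unique; so they glue.
\<close>

lemma Units_if_invertible_at:
  assumes inv: "\<And>x. x \<in> carrier C \<Longrightarrow> invertible_at f x"
  shows "f \<in> Units H"
proof -
  \<comment> \<open>At each point an arbitrary local inverse is chosen and evaluated at that same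
    point; \<open>S_eq\<close> shows that the choice does not affect the value.\<close>
  define S where "S = (\<lambda>x\<in>carrier C. (SOME p. p \<in> carrier H \<and> inverts_at f p x) x)"
  have S_eq: "S x = p x" if "p \<in> carrier H" "inverts_at f p x" "x \<in> carrier C" for p x
  proof -
    have "(SOME p. p \<in> carrier H \<and> inverts_at f p x) \<in> carrier H \<and>
        inverts_at f (SOME p. p \<in> carrier H \<and> inverts_at f p x) x"
      by (rule someI[of _ p]) (use that in simp)
    then show ?thesis
      using that by (auto simp: S_def intro: inverts_at_unique)
  qed
  \<comment> \<open>On every finite set \<open>S\<close> agrees with a single element of
    \<open>H\<close>. The linearity laws, each involving at most three points, are read off from
    such an element.\<close>
  have local: "\<exists>p\<in>carrier H. \<forall>y\<in>Y. inverts_at f p y \<and> S y = p y"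
    if "finite Y" "Y \<subseteq> carrier C" for Y
    using inverts_at_finite[OF that(1)] that inv S_eq by (meson subsetD)
  have S: "S \<in> carrier H"
    unfolding carrier_H
  proof (intro IntI linear_mapsI)
    fix x assume x: "x \<in> carrier C"
    obtain p where p: "p \<in> carrier H" "inverts_at f p x" "S x = p x"
      using local[of "{x}"] x by auto
    show "S x \<in> carrier A" using p x by simp
    { fix y assume y: "y \<in> carrier C"
      obtain q where "q \<in> carrier H" "S x = q x" "S y = q y" "S (x \<oplus>\<^bsub>C\<^esub> y) = q (x \<oplus>\<^bsub>C\<^esub> y)"
        using local[of "{x, y, x \<oplus>\<^bsub>C\<^esub> y}"] x y by auto
      then show "S (x \<oplus>\<^bsub>C\<^esub> y) = S x \<oplus>\<^bsub>A\<^esub> S y"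
        using x y linear_mapsD(2)[OF H_linear] by simp }
    fix a assume a: "a \<in> carrier R"
    obtain q where "q \<in> carrier H" "S x = q x" "S (a \<odot>\<^bsub>C\<^esub> x) = q (a \<odot>\<^bsub>C\<^esub> x)"
      using local[of "{x, a \<odot>\<^bsub>C\<^esub> x}"] x a by auto
    then show "S (a \<odot>\<^bsub>C\<^esub> x) = a \<odot>\<^bsub>A\<^esub> S x"
      using x a linear_mapsD(3)[OF H_linear] by simp
  qed (simp add: S_def)
  have "(f \<otimes>\<^bsub>H\<^esub> S) x = \<one>\<^bsub>H\<^esub> x \<and> (S \<otimes>\<^bsub>H\<^esub> f) x = \<one>\<^bsub>H\<^esub> x" if x: "x \<in> carrier C" for x
  proof -
    obtain Y where Y: "Y \<subseteq> carrier C" "finite Y"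
      "\<And>p q. p \<in> carrier H \<Longrightarrow> q \<in> carrier H \<Longrightarrow> (\<forall>y\<in>Y. p y = q y) \<Longrightarrow>
        pairing f p (comult C x) = pairing f q (comult C x) \<and>
        pairing p f (comult C x) = pairing q f (comult C x)"
      using pairing_finite_dependence[OF comult_closed[OF x]] by blast
    \<comment> \<open>Agreement on \<open>Y\<close> lets \<open>p\<close> replace \<open>S\<close>
      in both products at \<open>x\<close>, and inserting \<open>x\<close> makes these products
      equal to the unit there.\<close>
    obtain p where p: "p \<in> carrier H" "\<forall>y\<in>insert x Y. inverts_at f p y \<and> S y = p y"
      using local[of "insert x Y"] x Y by auto
    have "(\<one>\<^bsub>H\<^esub> \<ominus>\<^bsub>H\<^esub> f \<otimes>\<^bsub>H\<^esub> p) x = \<zero>\<^bsub>A\<^esub>" "(\<one>\<^bsub>H\<^esub> \<ominus>\<^bsub>H\<^esub> p \<otimes>\<^bsub>H\<^esub> f) x = \<zero>\<^bsub>A\<^esub>"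
      using p(2) by (auto simp: inverts_at_def intro!: annihilatorD)
    then have "(f \<otimes>\<^bsub>H\<^esub> p) x = \<one>\<^bsub>H\<^esub> x" "(p \<otimes>\<^bsub>H\<^esub> f) x = \<one>\<^bsub>H\<^esub> x"
      using f p(1) x by (simp_all add: H_minus_apply A.M.minus_eq_zero_iff)
    moreover have "(f \<otimes>\<^bsub>H\<^esub> S) x = (f \<otimes>\<^bsub>H\<^esub> p) x" "(S \<otimes>\<^bsub>H\<^esub> f) x = (p \<otimes>\<^bsub>H\<^esub> f) x"
      using Y(3)[OF S p(1)] p(2) x by (simp_all add: H_mult_apply)
    ultimately show ?thesis by simp
  qed
  then have "f \<otimes>\<^bsub>H\<^esub> S = \<one>\<^bsub>H\<^esub>" "S \<otimes>\<^bsub>H\<^esub> f = \<one>\<^bsub>H\<^esub>"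
    using f S by (auto intro!: H_eqI)
  then show ?thesis
    using f S unfolding Units_def by blast
qed

end

text \<open>Evaluation at a grouplike element is multiplicative and takes the convolution unit to
  \<open>\<one>\<close> of \<open>A\<close>, so it sends inverses to inverses.\<close>

lemma Units_grouplike:
  assumes f: "f \<in> Units H" and g: "g \<in> gpl R C"
  shows "f g \<in> Units A"
proof -
  have g': "g \<in> carrier C" "comult C g = pure_tensor R C C g g" "counit C g = \<one>\<^bsub>R\<^esub>"
    using g by (auto simp: gpl_def)
  obtain S where S: "S \<in> carrier H" "S \<otimes>\<^bsub>H\<^esub> f = \<one>\<^bsub>H\<^esub>" "f \<otimes>\<^bsub>H\<^esub> S = \<one>\<^bsub>H\<^esub>"
    using f by (auto simp: Units_def)
  have f': "f \<in> carrier H" using f by (rule H.Units_closed)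
  have "S g \<otimes>\<^bsub>A\<^esub> f g = \<one>\<^bsub>A\<^esub>" "f g \<otimes>\<^bsub>A\<^esub> S g = \<one>\<^bsub>A\<^esub>"
    using S(2,3) g' f' S(1) by (simp_all add: H_mult_grouplike[symmetric] H_one_apply)
  then show ?thesis
    using f' S(1) g'(1) unfolding Units_def by force
qed

text \<open>Since \<open>sgpl R C\<close> equals \<open>gpl R C\<close>, the values of
  \<open>f\<close> that are assumed to be units cover all endpoints of the filtration; since the
  filtration exhausts \<open>C\<close>, invertibility then reaches every point.\<close>

lemma Units_iff_grouplike:
  assumes C: "pathlike R C" and f: "f \<in> carrier H"
  shows "f \<in> Units H \<longleftrightarrow> (\<forall>g\<in>gpl R C. f g \<in> Units A)"
proof (intro iffI ballI)
  assume units: "\<forall>g\<in>gpl R C. f g \<in> Units A"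
  have sgpl: "sgpl R C = gpl R C" and flavored: "carrier C = (\<Union>n. quillen_total R C n)"
    using C by (auto simp: pathlike_def sg_flavored_def)
  have gpl: "invertible_at f g" if "g \<in> sgpl R C" for g
    using units that by (auto simp: sgpl intro!: invertible_at_grouplike[OF f])
  show "f \<in> Units H"
  proof (rule Units_if_invertible_at[OF f])
    fix x assume "x \<in> carrier C"
    then obtain n where x: "x \<in> quillen_total R C n" using flavored by auto
    let ?S = "\<Union>g\<in>sgpl R C. \<Union>h\<in>sgpl R C. quillen R C n g h"
    have S: "invertible_at f s" if "s \<in> ?S" for s
      using invertible_at_quillen[OF f gpl] \<open>s \<in> ?S\<close> by blast
    then have "?S \<subseteq> carrier C" by (auto simp: invertible_at_def)
    moreover have "x \<in> finite_sums C ?S" using x by (simp add: quillen_total_def)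
    ultimately show "invertible_at f x"
    proof (induction rule: C.M.finite_sums_induct)
      case zero
      \<comment> \<open>The empty sum: linear maps vanish at zero, so every element of
        \<open>H\<close> lies in the ideal of this point and any candidate inverse works.\<close>
      have "inverts_at f \<zero>\<^bsub>H\<^esub> \<zero>\<^bsub>C\<^esub>"
        using f by (simp add: inverts_at_def annihilator_zero)
      then show ?case by (auto simp: invertible_at_def)
    next
      case (add y s)
      show ?case by (rule invertible_at_add[OF f add.IH S[OF add.hyps(3)]])
    qed
  qed
qed (rule Units_grouplike)

end

section \<open>Bialgebras and antipodes\<close>

context
  fixes R :: "('r, 'x) ring_scheme" and A :: "('r, 'a, 'y) module_scheme"
    and B :: "('r, 'b, 'z) module_scheme"
  assumes A: "unital_algebra R A" and B: "unital_algebra R B"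
begin

interpretation A: unital_algebra R A by (rule A)
interpretation B: unital_algebra R B by (rule B)
interpretation AB: module_pair R A B
  by (intro module_pair.intro A.module_axioms B.module_axioms)

lemma tensor_algebra_simps:
  "carrier (tensor_algebra R A B) = carrier AB.TP"
  "\<one>\<^bsub>tensor_algebra R A B\<^esub> = pure_tensor R A B \<one>\<^bsub>A\<^esub> \<one>\<^bsub>B\<^esub>"
  "s \<otimes>\<^bsub>tensor_algebra R A B\<^esub> t = tensor_lift R AB.TP (\<lambda>x y. tensor_lift R AB.TP
     (\<lambda>x' y'. pure_tensor R A B (x \<otimes>\<^bsub>A\<^esub> x') (y \<otimes>\<^bsub>B\<^esub> y')) t) s"
  by (simp_all add: tensor_algebra_def Let_def)

lemma tensor_algebra_inner_bilinear:
  assumes "x \<in> carrier A" "y \<in> carrier B"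
  shows "bilinear R A B AB.TP (\<lambda>x' y'. pure_tensor R A B (x \<otimes>\<^bsub>A\<^esub> x') (y \<otimes>\<^bsub>B\<^esub> y'))"
  using assms by (intro bilinearI linear_mapsI)
    (simp_all add: AB.pure_tensor_simps A.A.r_distr B.A.r_distr A.smult_mult_right B.smult_mult_right)

lemma tensor_algebra_outer_bilinear:
  assumes t: "t \<in> carrier AB.TP"
  shows "bilinear R A B AB.TP (\<lambda>x y. tensor_lift R AB.TP
     (\<lambda>x' y'. pure_tensor R A B (x \<otimes>\<^bsub>A\<^esub> x') (y \<otimes>\<^bsub>B\<^esub> y')) t)"
proof (rule bilinearI)
  fix x assume x: "x \<in> carrier A"
  show "(\<lambda>y. tensor_lift R AB.TP (\<lambda>x' y'. pure_tensor R A B (x \<otimes>\<^bsub>A\<^esub> x') (y \<otimes>\<^bsub>B\<^esub> y')) t)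
      \<in> linear_maps R B AB.TP"
    using x by (intro AB.tensor_lift_param_linear[OF AB.tensor_module B.module_axioms _ _ t]
        tensor_algebra_inner_bilinear linear_mapsI)
      (simp_all add: AB.pure_tensor_simps B.A.l_distr B.smult_mult_left)
next
  fix y assume y: "y \<in> carrier B"
  show "(\<lambda>x. tensor_lift R AB.TP (\<lambda>x' y'. pure_tensor R A B (x \<otimes>\<^bsub>A\<^esub> x') (y \<otimes>\<^bsub>B\<^esub> y')) t)
      \<in> linear_maps R A AB.TP"
    using y by (intro AB.tensor_lift_param_linear[OF AB.tensor_module A.module_axioms _ _ t]
        tensor_algebra_inner_bilinear linear_mapsI)
      (simp_all add: AB.pure_tensor_simps A.A.l_distr A.smult_mult_left)
qed

lemma tensor_algebra_mult_linear:
  assumes t: "t \<in> carrier AB.TP"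
  shows "(\<lambda>s. s \<otimes>\<^bsub>tensor_algebra R A B\<^esub> t) \<in> linear_maps R AB.TP AB.TP"
  unfolding tensor_algebra_simps
  by (rule AB.tensor_lift_linear[OF AB.tensor_module tensor_algebra_outer_bilinear[OF t]])

lemma tensor_algebra_mult_pure:
  assumes "a \<in> carrier A" "b \<in> carrier B" "c \<in> carrier A" "d \<in> carrier B"
  shows "pure_tensor R A B a b \<otimes>\<^bsub>tensor_algebra R A B\<^esub> pure_tensor R A B c d =
    pure_tensor R A B (a \<otimes>\<^bsub>A\<^esub> c) (b \<otimes>\<^bsub>B\<^esub> d)"
  unfolding tensor_algebra_simps using assms
  by (simp add: AB.tensor_lift_pure[OF AB.tensor_module tensor_algebra_outer_bilinear]
      AB.tensor_lift_pure[OF AB.tensor_module tensor_algebra_inner_bilinear])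

text \<open>The case of associativity with two pure factors on the right, proved by linearity in the
  left factor. It lets \<open>gpl_inverse\<close> cancel the square tensor of \<open>g\<close>
  against that of \<open>h\<close>, next to a comultiplication that is not yet known to be
  pure.\<close>

lemma tensor_algebra_mult_assoc_pure:
  assumes t: "t \<in> carrier AB.TP"
    and [simp]: "a \<in> carrier A" "b \<in> carrier B" "c \<in> carrier A" "d \<in> carrier B"
  shows "(t \<otimes>\<^bsub>tensor_algebra R A B\<^esub> pure_tensor R A B a b)
      \<otimes>\<^bsub>tensor_algebra R A B\<^esub> pure_tensor R A B c d =
    t \<otimes>\<^bsub>tensor_algebra R A B\<^esub> pure_tensor R A B (a \<otimes>\<^bsub>A\<^esub> c) (b \<otimes>\<^bsub>B\<^esub> d)"
  by (rule AB.tensor_linear_eqI[OF AB.T.M.abelian_monoid_axioms linear_maps_compose[OF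
        tensor_algebra_mult_linear tensor_algebra_mult_linear] tensor_algebra_mult_linear _ t])
    (simp_all add: tensor_algebra_mult_pure A.A.m_assoc B.A.m_assoc)

lemma tensor_algebra_mult_one:
  assumes t: "t \<in> carrier AB.TP"
  shows "t \<otimes>\<^bsub>tensor_algebra R A B\<^esub> \<one>\<^bsub>tensor_algebra R A B\<^esub> = t"
  unfolding tensor_algebra_simps(2)
  by (rule AB.tensor_linear_eqI[OF AB.T.M.abelian_monoid_axioms tensor_algebra_mult_linear _ _ t])
    (simp_all add: tensor_algebra_mult_pure linear_maps_def)

end

section \<open>Grouplike elements and antipodes of a bialgebra\<close>

context bialgebra
begin

lemma B_unital_algebra: "unital_algebra R B"
  by unfold_locales

lemma B_convolution: "convolution R B B"
  by unfold_locales

interpretation conv: convolution R B B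
  by (rule B_convolution)

lemma id_linear: "(\<lambda>x. x) \<in> linear_maps R B B"
  by (simp add: linear_maps_def)

lemma gplD:
  assumes "g \<in> gpl R B"
  shows "g \<in> carrier B" "comult B g = pure_tensor R B B g g" "counit B g = \<one>\<^bsub>R\<^esub>"
  using assms by (auto simp: gpl_def)

lemma gpl_one: "\<one>\<^bsub>B\<^esub> \<in> gpl R B"
  using ring_hom_one[OF comult_ring_hom] ring_hom_one[OF counit_ring_hom]
  by (simp add: gpl_def tensor_algebra_simps[OF B_unital_algebra B_unital_algebra])

lemma gpl_mult:
  assumes "g \<in> gpl R B" "h \<in> gpl R B"
  shows "g \<otimes>\<^bsub>B\<^esub> h \<in> gpl R B"
  using gplD[OF assms(1)] gplD[OF assms(2)] ring_hom_mult[OF comult_ring_hom, of g h]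
    ring_hom_mult[OF counit_ring_hom, of g h]
  by (simp add: gpl_def tensor_algebra_mult_pure[OF B_unital_algebra B_unital_algebra])

text \<open>
  An inverse of a grouplike element is grouplike because its comultiplication and \<open>h \<otimes> h\<close> are
  inverses of the same element \<open>g \<otimes> g\<close> of the tensor square.
\<close>

lemma gpl_inverse:
  assumes g: "g \<in> gpl R B" and h: "h \<in> carrier B"
    and gh: "g \<otimes>\<^bsub>B\<^esub> h = \<one>\<^bsub>B\<^esub>" and hg: "h \<otimes>\<^bsub>B\<^esub> g = \<one>\<^bsub>B\<^esub>"
  shows "h \<in> gpl R B"
proof -
  let ?T = "tensor_algebra R B B" and ?p = "pure_tensor R B B"
  note g' = gplD[OF g]
  note mult_pure = tensor_algebra_mult_pure[OF B_unital_algebra B_unital_algebra]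
  note T = tensor_algebra_simps(1,2)[OF B_unital_algebra B_unital_algebra]
  have "comult B h = comult B h \<otimes>\<^bsub>?T\<^esub> ?p (g \<otimes>\<^bsub>B\<^esub> h) (g \<otimes>\<^bsub>B\<^esub> h)"
    using tensor_algebra_mult_one[OF B_unital_algebra B_unital_algebra, of "comult B h"] h gh
    by (simp add: T)
  also have "\<dots> = (comult B h \<otimes>\<^bsub>?T\<^esub> ?p g g) \<otimes>\<^bsub>?T\<^esub> ?p h h"
    using g' h by (simp add: tensor_algebra_mult_assoc_pure[OF B_unital_algebra B_unital_algebra])
  also have "comult B h \<otimes>\<^bsub>?T\<^esub> ?p g g = \<one>\<^bsub>?T\<^esub>"
    using ring_hom_mult[OF comult_ring_hom h g'(1)] ring_hom_one[OF comult_ring_hom] g' hg by simp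
  also have "\<one>\<^bsub>?T\<^esub> \<otimes>\<^bsub>?T\<^esub> ?p h h = ?p h h"
    using h by (simp add: T mult_pure)
  finally have "comult B h = ?p h h" .
  moreover have "counit B h = \<one>\<^bsub>R\<^esub>"
    using ring_hom_mult[OF counit_ring_hom h g'(1)] ring_hom_one[OF counit_ring_hom] g' h hg by simp
  ultimately show ?thesis
    using h by (simp add: gpl_def)
qed

text \<open>Products and the unit stay grouplike because comultiplication and counit are ring
  homomorphisms; inverses taken in \<open>B\<close> stay grouplike by
  \<open>gpl_inverse\<close>.\<close>

lemma group_gplI:
  assumes "\<And>g. g \<in> gpl R B \<Longrightarrow> g \<in> Units B"
  shows "group (B\<lparr>carrier := gpl R B\<rparr>)"
proof (rule groupI)
  fix g assume "g \<in> carrier (B\<lparr>carrier := gpl R B\<rparr>)"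
  then have g: "g \<in> gpl R B" by simp
  obtain h where "h \<in> carrier B" "h \<otimes>\<^bsub>B\<^esub> g = \<one>\<^bsub>B\<^esub>" "g \<otimes>\<^bsub>B\<^esub> h = \<one>\<^bsub>B\<^esub>"
    using assms[OF g] by (auto simp: Units_def)
  then show "\<exists>h\<in>carrier (B\<lparr>carrier := gpl R B\<rparr>).
      h \<otimes>\<^bsub>B\<lparr>carrier := gpl R B\<rparr>\<^esub> g = \<one>\<^bsub>B\<lparr>carrier := gpl R B\<rparr>\<^esub>"
    using gpl_inverse[OF g] by auto
qed (simp_all add: gpl_one gpl_mult gplD A.m_assoc)

lemma Units_if_group_gpl:
  assumes "group (B\<lparr>carrier := gpl R B\<rparr>)" and g: "g \<in> gpl R B"
  shows "g \<in> Units B"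
proof -
  interpret G: group "B\<lparr>carrier := gpl R B\<rparr>" by fact
  \<comment> \<open>The record update changes only the carrier, so an inverse in the group is an
    inverse in \<open>B\<close>.\<close>
  obtain h where "h \<in> gpl R B" "h \<otimes>\<^bsub>B\<^esub> g = \<one>\<^bsub>B\<^esub>" "g \<otimes>\<^bsub>B\<^esub> h = \<one>\<^bsub>B\<^esub>"
    using G.Units_eq g by (auto simp: Units_def)
  then show ?thesis
    using gplD[OF g] gplD(1) unfolding Units_def by blast
qed

lemma antipode_iff_pairing:
  "antipode R B S \<longleftrightarrow> S \<in> linear_maps R B B \<and>
     (\<forall>x\<in>carrier B. conv.pairing S (\<lambda>x. x) (comult B x) = counit B x \<odot>\<^bsub>B\<^esub> \<one>\<^bsub>B\<^esub> \<and>
       conv.pairing (\<lambda>x. x) S (comult B x) = counit B x \<odot>\<^bsub>B\<^esub> \<one>\<^bsub>B\<^esub>)"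
  by (simp add: antipode_def conv.pairing_def)

text \<open>At a grouplike \<open>g\<close> the counit is one and the comultiplication is pure, so
  the antipode equations say that \<open>S g\<close> is a two-sided inverse of
  \<open>g\<close>.\<close>

lemma Units_if_antipode:
  assumes S: "antipode R B S" and g: "g \<in> gpl R B"
  shows "g \<in> Units B"
proof -
  note g' = gplD[OF g]
  have S': "S \<in> linear_maps R B B" using S by (simp add: antipode_def)
  have "S g \<otimes>\<^bsub>B\<^esub> g = \<one>\<^bsub>B\<^esub>" "g \<otimes>\<^bsub>B\<^esub> S g = \<one>\<^bsub>B\<^esub>"
    using S g' unfolding antipode_iff_pairing
    by (auto simp: conv.pairing_pure id_linear)
  then show ?thesis
    using linear_mapsD(1)[OF S' g'(1)] g'(1) unfolding Units_def by blast
qed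

lemma antipode_if_Units:
  assumes "(\<lambda>x\<in>carrier B. x) \<in> Units (convolution_algebra R B B)"
  shows "\<exists>S. antipode R B S"
proof -
  let ?i = "\<lambda>x\<in>carrier B. x"
  obtain S where S: "S \<in> carrier conv.H" "S \<otimes>\<^bsub>conv.H\<^esub> ?i = \<one>\<^bsub>conv.H\<^esub>" "?i \<otimes>\<^bsub>conv.H\<^esub> S = \<one>\<^bsub>conv.H\<^esub>"
    using assms by (auto simp: Units_def)
  note lin = conv.H_linear[OF S(1)] id_linear
  have "conv.pairing S (\<lambda>x. x) (comult B x) = counit B x \<odot>\<^bsub>B\<^esub> \<one>\<^bsub>B\<^esub> \<and>
       conv.pairing (\<lambda>x. x) S (comult B x) = counit B x \<odot>\<^bsub>B\<^esub> \<one>\<^bsub>B\<^esub>" if x: "x \<in> carrier B" for x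
  proof -
    \<comment> \<open>The convolution algebra contains only extensional maps, whereas the antipode
      equations use the plain identity; the two agree on the carrier.\<close>
    have "conv.pairing S ?i (comult B x) = conv.pairing S (\<lambda>x. x) (comult B x)"
      "conv.pairing ?i S (comult B x) = conv.pairing (\<lambda>x. x) S (comult B x)"
      using x by (intro conv.pairing_cong lin; simp)+
    then show ?thesis
      using fun_cong[OF S(2), of x] fun_cong[OF S(3), of x] x
      by (simp add: conv.H_mult_apply conv.H_one_apply)
  qed
  then show ?thesis
    using lin(1) unfolding antipode_iff_pairing by blast
qed

lemma hopf_algebra_iff_group_gpl:
  assumes "pathlike R B"
  shows "hopf_algebra R B \<longleftrightarrow> group (B\<lparr>carrier := gpl R B\<rparr>)"
proof
  assume "hopf_algebra R B"
  then show "group (B\<lparr>carrier := gpl R B\<rparr>)"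
    unfolding hopf_algebra_def by (blast intro: group_gplI Units_if_antipode)
next
  assume G: "group (B\<lparr>carrier := gpl R B\<rparr>)"
  \<comment> \<open>For \<open>B\<close> as both coalgebra and algebra and for the identity map, the
    criterion asks precisely that each grouplike element be a unit of \<open>B\<close>.\<close>
  have "(\<lambda>x\<in>carrier B. x) \<in> Units conv.H"
    using Units_if_group_gpl[OF G] gplD(1)
    by (simp add: conv.Units_iff_grouplike[OF assms conv.H_restrict[OF id_linear]])
  then show "hopf_algebra R B"
    unfolding hopf_algebra_def using antipode_if_Units bialgebra_axioms by blast
qed

end

section \<open>The invertibility criterion and its consequences for characters and Hopf
  algebras\<close>

theorem theorem3p21:
  fixes R :: "('r, 'x) ring_scheme"
    and C :: "('r, 'c, 'y) coalgebra_scheme"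
    and A :: "('r, 'a, 'z) module_scheme"
    and B :: "('r, 'b, 'w) coalgebra_scheme"
  assumes "cring R"
  shows "(pathlike R C \<and> unital_algebra R A \<and>
            carrier (Ext1 R (quotient_module C (quillen_total R C 0)) A) =
              {\<zero>\<^bsub>Ext1 R (quotient_module C (quillen_total R C 0)) A\<^esub>} \<longrightarrow>
          (\<forall>f \<in> carrier (convolution_algebra R C A).
             f \<in> Units (convolution_algebra R C A) \<longleftrightarrow> (\<forall>g \<in> gpl R C. f g \<in> Units A)) \<and>
          (bialgebra R C \<longrightarrow>
             (\<forall>\<phi> \<in> characters R C A.
                \<phi> \<in> Units (convolution_algebra R C A) \<longleftrightarrow> grouplike_invertible R C A \<phi>)))
       \<and> (bialgebra R B \<and> pathlike R B \<longrightarrow>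
            (hopf_algebra R B \<longleftrightarrow> group (B\<lparr>carrier := gpl R B\<rparr>)))"
proof (intro conjI impI ballI)
  assume asm: "pathlike R C \<and> unital_algebra R A \<and>
            carrier (Ext1 R (quotient_module C (quillen_total R C 0)) A) =
              {\<zero>\<^bsub>Ext1 R (quotient_module C (quillen_total R C 0)) A\<^esub>}"
  then interpret convolution R C A
    by (intro convolution.intro) (auto simp: pathlike_def)
  have C: "pathlike R C" using asm by simp
  show "f \<in> Units H \<longleftrightarrow> (\<forall>g \<in> gpl R C. f g \<in> Units A)" if "f \<in> carrier H" for f
    using C that by (rule Units_iff_grouplike)
  \<comment> \<open>A character is in particular an element of \<open>H\<close>, so its claim is an
    instance of the same criterion.\<close>
  fix \<phi> assume "\<phi> \<in> characters R C A"
  then have "\<phi> \<in> carrier H"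
    by (simp add: characters_def convolution_algebra_def)
  then show "\<phi> \<in> Units H \<longleftrightarrow> grouplike_invertible R C A \<phi>"
    unfolding grouplike_invertible_def using C by (intro Units_iff_grouplike)
next
  assume "bialgebra R B \<and> pathlike R B"
  then show "hopf_algebra R B \<longleftrightarrow> group (B\<lparr>carrier := gpl R B\<rparr>)"
    using bialgebra.hopf_algebra_iff_group_gpl by blast
qed

end
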